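(* Let $\alpha\in(0,1)$, $\lambda>0$, $L>0$. Assume that $g:\mathbb{R}^d\to[0,\infty)$ is Lipschitz continuous with Lipschitz constant $\mathrm{Lip}(g)$ and $g\in C^1$ for $g(x)\neq0$. Let $P,Q\in\mathcal{P}(\mathbb{R}^d)$ satisfy $\mathbb{E}_P[g]<\infty$ and $\mathbb{E}_Q[g]<\infty$, and assume that $Q$ has finite first moment. Let $\Delta C(Q;P)=\mathrm{CVaR}_\alpha^{P,g}-\mathrm{CVaR}_\alpha^{Q,g}$ and $\mathcal{F}(Q;P)=D^L_{\mathrm{KL}}(Q\|P)+\lambda(\Delta C(Q;P))^2$. For every $y\in T(Q)=[\mathrm{VaR}_\alpha^{Q,g},\overline{\mathrm{VaR}}_\alpha^{Q,g}]$, the velocity field $$v_Q^y(x)=\begin{cases}-\nabla_x\phi^*(x)+\dfrac{2\lambda}{1-\alpha}\,\Delta C(Q;P)\,\nabla_x g(x), & g(x)>y,\\[2mm] -\nabla_x\phi^*(x), & g(x)\le y,\end{cases}$$ satisfies, for almost every $x\in\mathbb{R}^d$, $$\|v_Q^y(x)\|\le L+\frac{2\lambda}{1-\alpha}\,\mathrm{Lip}(g)\,|\Delta C(Q;P)|.$$ Moreover, the CVaR discrepancy is controlled by the loss $\mathcal{F}(Q;P)$, so we have $$\|v_Q^y(x)\|\le L+\frac{2\,\mathrm{Lip}(g)}{1-\alpha}\sqrt{\lambda\,\mathcal{F}(Q;P)}$$ for almost every $x\in\mathbb{R}^d$. In particular, the velocity field is bounded, and the CVaR-penalization component vanishes as $\mathcal{F}(Q;P)\to0$,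 i.e. as $Q\to P$.
   Context: $\mathcal{P}(\mathbb{R}^d)$ is the set of probability measures on $\mathbb{R}^d$; $P$ is the target distribution. $\Gamma_L$ is the space of $L$-Lipschitz functions $\mathbb{R}^d\to\mathbb{R}$. The Lipschitz-regularized KL divergence is $D^L_{\mathrm{KL}}(Q\|P)=\inf_{\gamma\in\mathcal{P}(\mathbb{R}^d)}\{D_{\mathrm{KL}}(\gamma\|P)+L\,\mathcal{W}_1(Q,\gamma)\}=\sup_{\phi\in\Gamma_L}\{\mathbb{E}_Q[\phi]-\log\mathbb{E}_P[e^\phi]\}$ (known equality), with $D_{\mathrm{KL}}$ the Kullback–Leibler divergence and $\mathcal{W}_1$ the Wasserstein-1 metric. $\phi^*\in\Gamma_L$ denotes the maximizer of the supremum; it is known to exist and to be unique on $\mathrm{supp}(Q)\cup\mathrm{supp}(P)$ when $Q$ has finite first moment. VaR and CVaR. For $Q$ with $\mathbb{E}_Q[g]<\infty$, let $\Psi^{Q,g}(c)=Q(g\le c)$, $\mathrm{VaR}_\alpha^{Q,g}:=\inf\{c\in\mathbb{R}:\Psi^{Q,g}(c)\ge\alpha\}$ and $\overline{\mathrm{VaR}}_\alpha^{Q,g}:=\inf\{c\in\mathbb{R}:\Psi^{Q,g}(c)>\alpha\}$. The Conditional Value-at-Risk is $\mathrm{CVaR}_\alpha^{Q,g}=\inf_{y\in\mathbb{R}}\{y+\frac{1}{1-\alpha}\mathbb{E}_Q[(g-y)^+]\}$, and its set of minimizers is $T(Q)$. The CVaR-penalization component of the velocity field is the term $\frac{2\lambda}{1-\alpha}\,\Delta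 C(Q;P)\,\nabla_x g(x)$ present where $g(x)>y$. *)

theory Defs
  imports "HOL-Probability.Probability"
begin

definition prob_measures :: "'a::topological_space measure set" where
  "prob_measures = {M. prob_space M \<and> sets M = sets borel}"

definition Lip_functions :: "real \<Rightarrow> ('a::metric_space \<Rightarrow> real) set" where
  "Lip_functions L = {\<phi>. L-lipschitz_on UNIV \<phi>}"

definition finite_first_moment :: "'a::real_normed_vector measure \<Rightarrow> bool" where
  "finite_first_moment Q \<longleftrightarrow> integrable Q norm"

text \<open>Meaningful only where \<open>f\<close> is differentiable; no default value is chosen elsewhere.\<close>

definition grad :: "('a::real_inner \<Rightarrow> real) \<Rightarrow> 'a \<Rightarrow> 'a" where
  "grad f x = (THE D. GDERIV f x :> D)"

text \<open>Intended for open \<open>S\<close>.\<close>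

definition C1_on :: "'a::real_inner set \<Rightarrow> ('a \<Rightarrow> real) \<Rightarrow> bool" where
  "C1_on S f \<longleftrightarrow> (\<forall>x\<in>S. f differentiable (at x)) \<and> continuous_on S (grad f)"

text \<open>
  \<open>D_KL Q P\<close> is the divergence of \<open>Q\<close> from \<open>P\<close>, that is the \<open>Q\<close>-integral of
  \<open>ln (dQ/dP)\<close>; \<^const>\<open>KL_divergence\<close> takes its arguments in the opposite order and
  yields a meaningless real number when the divergence is infinite.  The negative part of
  \<open>ln (dQ/dP)\<close> is always \<open>Q\<close>-integrable, so failing integrability means the value \<open>\<infinity>\<close>.
\<close>

definition D_KL :: "'a measure \<Rightarrow> 'a measure \<Rightarrow> ereal" where
  "D_KL Q P =
     (if absolutely_continuous P Q \<and> integrable Q (entropy_density (exp 1) P Q)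
      then ereal (KL_divergence (exp 1) P Q) else \<infinity>)"

definition couplings :: "'a::topological_space measure \<Rightarrow> 'a measure \<Rightarrow> ('a \<times> 'a) measure set" where
  "couplings M N = {\<pi>\<in>prob_measures. distr \<pi> borel fst = M \<and> distr \<pi> borel snd = N}"

definition W1 :: "'a::metric_space measure \<Rightarrow> 'a measure \<Rightarrow> ennreal" where
  "W1 M N = (INF \<pi>\<in>couplings M N. \<integral>\<^sup>+ z. ennreal (dist (fst z) (snd z)) \<partial>\<pi>)"

definition lip_KL :: "real \<Rightarrow> 'a::metric_space measure \<Rightarrow> 'a measure \<Rightarrow> ereal" where
  "lip_KL L Q P =
     (INF \<gamma>\<in>prob_measures. D_KL \<gamma> P + ereal L * enn2ereal (W1 Q \<gamma>))"

text \<open>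
  For a Lipschitz \<open>\<phi>\<close>, the expectation of \<open>exp \<circ> \<phi>\<close> under \<open>P\<close> may be infinite; the objective is then
  \<open>-\<infinity>\<close>.  The \<open>Q\<close>-expectation of \<open>\<phi>\<close> is guaranteed to be finite when \<open>Q\<close> has a finite first moment.
\<close>

definition dual_objective :: "'a measure \<Rightarrow> 'a measure \<Rightarrow> ('a \<Rightarrow> real) \<Rightarrow> ereal" where
  "dual_objective Q P \<phi> =
     (if integrable P (\<lambda>x. exp (\<phi> x))
      then ereal ((\<integral>x. \<phi> x \<partial>Q) - ln (\<integral>x. exp (\<phi> x) \<partial>P)) else - \<infinity>)"

definition optimal_potential ::
    "real \<Rightarrow> 'a::metric_space measure \<Rightarrow> 'a measure \<Rightarrow> ('a \<Rightarrow> real) \<Rightarrow> bool" where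
  "optimal_potential L Q P \<phi> \<longleftrightarrow>
     is_arg_max (dual_objective Q P) (\<lambda>\<psi>. \<psi> \<in> Lip_functions L) \<phi>"

definition dist_fun :: "'a measure \<Rightarrow> ('a \<Rightarrow> real) \<Rightarrow> real \<Rightarrow> real" where
  "dist_fun Q g c = measure Q {x\<in>space Q. g x \<le> c}"

definition VaR :: "real \<Rightarrow> 'a measure \<Rightarrow> ('a \<Rightarrow> real) \<Rightarrow> real" where
  "VaR \<alpha> Q g = Inf {c. dist_fun Q g c \<ge> \<alpha>}"

definition VaR_upper :: "real \<Rightarrow> 'a measure \<Rightarrow> ('a \<Rightarrow> real) \<Rightarrow> real" where
  "VaR_upper \<alpha> Q g = Inf {c. dist_fun Q g c > \<alpha>}"

definition CVaR_objective :: "real \<Rightarrow> 'a measure \<Rightarrow> ('a \<Rightarrow> real) \<Rightarrow> real \<Rightarrow> real" where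
  "CVaR_objective \<alpha> Q g y = y + 1 / (1 - \<alpha>) * (\<integral>x. max 0 (g x - y) \<partial>Q)"

definition CVaR :: "real \<Rightarrow> 'a measure \<Rightarrow> ('a \<Rightarrow> real) \<Rightarrow> real" where
  "CVaR \<alpha> Q g = (INF y. CVaR_objective \<alpha> Q g y)"

definition CVaR_minimizers :: "real \<Rightarrow> 'a measure \<Rightarrow> ('a \<Rightarrow> real) \<Rightarrow> real set" where
  "CVaR_minimizers \<alpha> Q g = {y. is_arg_min (CVaR_objective \<alpha> Q g) (\<lambda>_. True) y}"

definition CVaR_gap :: "real \<Rightarrow> ('a \<Rightarrow> real) \<Rightarrow> 'a measure \<Rightarrow> 'a measure \<Rightarrow> real" where
  "CVaR_gap \<alpha> g Q P = CVaR \<alpha> P g - CVaR \<alpha> Q g"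

definition loss ::
    "real \<Rightarrow> real \<Rightarrow> real \<Rightarrow> ('a::metric_space \<Rightarrow> real) \<Rightarrow> 'a measure \<Rightarrow> 'a measure \<Rightarrow> ereal" where
  "loss L lam \<alpha> g Q P = lip_KL L Q P + ereal (lam * (CVaR_gap \<alpha> g Q P)\<^sup>2)"

definition velocity ::
    "real \<Rightarrow> real \<Rightarrow> ('a::real_inner \<Rightarrow> real) \<Rightarrow> 'a measure \<Rightarrow> 'a measure \<Rightarrow> ('a \<Rightarrow> real)
      \<Rightarrow> real \<Rightarrow> 'a \<Rightarrow> 'a" where
  "velocity lam \<alpha> g Q P \<phi> y x =
     (if g x > y
      then - grad \<phi> x + (2 * lam / (1 - \<alpha>) * CVaR_gap \<alpha> g Q P) *\<^sub>R grad g x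
      else - grad \<phi> x)"

definition CVaR_velocity_component ::
    "real \<Rightarrow> real \<Rightarrow> ('a::real_inner \<Rightarrow> real) \<Rightarrow> 'a measure \<Rightarrow> 'a measure
      \<Rightarrow> real \<Rightarrow> 'a \<Rightarrow> 'a" where
  "CVaR_velocity_component lam \<alpha> g Q P y x =
     (if g x > y then (2 * lam / (1 - \<alpha>) * CVaR_gap \<alpha> g Q P) *\<^sub>R grad g x else 0)"

definition converges_weakly ::
    "(nat \<Rightarrow> 'a::topological_space measure) \<Rightarrow> 'a measure \<Rightarrow> bool" where
  "converges_weakly Qs P \<longleftrightarrow>
     (\<forall>f::'a \<Rightarrow> real. continuous_on UNIV f \<and> bounded (range f)
        \<longrightarrow> (\<lambda>n. \<integral>x. f x \<partial>Qs n) \<longlonglongrightarrow> (\<integral>x. f x \<partial>P))"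

end

theory Submission
  imports Defs
begin

text \<open>
  The velocity bound needs the gradient of the \<open>L\<close>-Lipschitz potential almost everywhere, that is
  Rademacher's theorem.  On the line, a normalised Lipschitz function defines a Stieltjes measure
  dominated by Lebesgue measure, and Vitali's theorem compares it with multiples of Lebesgue
  measure on the set where the difference quotients oscillate across an interval; that set is null.
  Directional derivatives on a Euclidean space follow by Tonelli and translation invariance, they
  are almost everywhere linear in the direction, and a Lipschitz function whose directional
  derivatives along a dense set of directions are linear is differentiable.

  The set of CVaR minimizers comes from the two subgradient inequalities of the
  Rockafellar--Uryasev objective.  The inequality \<open>ln u \<le> u - 1\<close> gives a weak Donsker--Varadhan
  bound, which yields nonnegativity of the divergence and, for small loss, closeness of the
  integrals of bounded functions; the passage from Lipschitz to continuous test functions uses the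
  largest \<open>k\<close>-Lipschitz minorants.
\<close>

subsection \<open>Lipschitz functions on the real line\<close>

text \<open>The potential is merely Lipschitz and \<open>grad\<close> has no default value, so a
  gradient bound must first secure differentiability, and for \<phi> this holds only off a null set.
  For g it comes pointwise: minimizers y are nonnegative, so g > y forces g \<noteq> 0, where g is
  C1. Hence the CVaR component is bounded at every point and vanishes uniformly. The Vitali
  comparison works because all measures involved are dominated by a multiple of Lebesgue measure:
  the null set missed by disjoint intervals costs nothing, and the set by which they overshoot costs
  arbitrarily little. On the divergence side two scales compete: testing with t * f costs the
  divergence over t plus a term of order t, so t is fixed before the divergence becomes small. The
  regularization supplies an intermediate \<gamma>: Lipschitz functions pass from Q to \<gamma>
  through W1, bounded ones from \<gamma> to P through the divergence, so test functions must at
  first be both. The loss is an extended real; its finiteness is what makes its square root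
  meaningful.\<close>

lemma vitali_emeasure_le:
  fixes \<mu> \<nu> :: "real measure"
  assumes [simp, measurable_cong]: "sets \<mu> = sets borel" "sets \<nu> = sets borel"
    and \<mu>: "\<And>A. A \<in> sets borel \<Longrightarrow> emeasure \<mu> A \<le> ennreal C * emeasure lborel A"
    and \<nu>: "\<And>A. A \<in> sets borel \<Longrightarrow> emeasure \<nu> A \<le> ennreal C * emeasure lborel A"
    and C: "0 < C"
    and E: "E \<in> sets borel" "emeasure lborel E < \<infinity>"
    and cover: "\<And>x d. x \<in> E \<Longrightarrow> 0 < d \<Longrightarrow>
      \<exists>a b. a \<le> x \<and> x \<le> b \<and> a < b \<and> b - a < d \<and> emeasure \<mu> {a..b} \<le> emeasure \<nu> {a..b}"
  shows "emeasure \<mu> E \<le> emeasure \<nu> E"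
proof (rule ennreal_le_epsilon)
  fix e :: real assume "0 < e"
  then have "0 < e / C" using C by simp
  \<comment> \<open>With |V - E| < e / C, a covering inside V overestimates \<open>\<nu> E\<close>
    by at most e, since \<nu> is dominated by C times Lebesgue measure.\<close>
  then obtain V where V: "open V" "E \<subseteq> V" "emeasure lborel (V - E) < ennreal (e / C)"
    using outer_regular_lborel[OF E(1), of "e / C"] by auto
  define K where "K = {i::real \<times> real. 0 < snd i \<and> cball (fst i) (snd i) \<subseteq> V \<and>
      emeasure \<mu> (cball (fst i) (snd i)) \<le> emeasure \<nu> (cball (fst i) (snd i))}"
  obtain I where I: "countable I" "I \<subseteq> K"
    "pairwise (\<lambda>i j. disjnt (cball (fst i) (snd i)) (cball (fst j) (snd j))) I"
    "negligible (E - (\<Union>i\<in>I. cball (fst i) (snd i)))"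
  proof (rule Vitali_covering_theorem_cballs[of K snd E fst])
    show "\<And>i. i \<in> K \<Longrightarrow> 0 < snd i" by (simp add: K_def)
    fix x d :: real assume x: "x \<in> E" and d: "0 < d"
    then obtain \<delta> where \<delta>: "0 < \<delta>" "ball x \<delta> \<subseteq> V"
      using V by (meson openE subsetD)
    obtain a b where ab: "a \<le> x" "x \<le> b" "a < b" "b - a < min d \<delta>"
        "emeasure \<mu> {a..b} \<le> emeasure \<nu> {a..b}"
      using cover[OF x, of "min d \<delta>"] d \<delta> by auto
    \<comment> \<open>The interval need not be centred at x: Vitali's theorem asks only for a ball
      containing x, so midpoint and half length serve as the index.\<close>
    have eq: "cball ((a + b) / 2) ((b - a) / 2) = {a..b}"
      by (auto simp: cball_def dist_real_def field_simps abs_if split: if_splits)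
    have "{a..b} \<subseteq> ball x \<delta>"
      using ab by (auto simp: dist_real_def)
    then show "\<exists>i. i \<in> K \<and> x \<in> cball (fst i) (snd i) \<and> snd i < d"
      using ab \<delta> eq by (intro exI[of _ "((a + b) / 2, (b - a) / 2)"]) (auto simp: K_def)
  qed
  let ?U = "\<Union>i\<in>I. cball (fst i) (snd i)"
  have U: "?U \<in> sets borel" using I(1) by (auto intro!: sets.countable_UN')
  have "emeasure lborel (E - ?U) = 0"
    using I(4) U E(1) by (simp add: negligible_iff_null_sets null_sets_def)
  then have null: "emeasure \<mu> (E - ?U) = 0"
    using \<mu>[of "E - ?U"] U E(1) by simp
  have sum: "emeasure M ?U = (\<integral>\<^sup>+i. emeasure M (cball (fst i) (snd i)) \<partial>count_space I)"
    if "sets M = sets borel" for M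
    using I(1,3) that by (intro emeasure_UN_countable)
      (auto simp: disjoint_family_on_def pairwise_def disjnt_def)
  have "emeasure \<mu> E \<le> emeasure \<mu> ((E - ?U) \<union> ?U)"
    using U E(1) by (intro emeasure_mono) auto
  also have "\<dots> \<le> emeasure \<mu> (E - ?U) + emeasure \<mu> ?U"
    using U E(1) by (intro emeasure_subadditive) auto
  also have "\<dots> = emeasure \<mu> ?U" by (simp add: null)
  also have "\<dots> \<le> emeasure \<nu> ?U"
    unfolding sum[OF assms(1)] sum[OF assms(2)]
    using I(2) by (intro nn_integral_mono) (auto simp: K_def)
  also have "\<dots> \<le> emeasure \<nu> (E \<union> (V - E))"
    using I(2) V E(1) by (intro emeasure_mono) (auto simp: K_def)
  also have "\<dots> \<le> emeasure \<nu> E + emeasure \<nu> (V - E)"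
    using V E(1) by (intro emeasure_subadditive) auto
  also have "emeasure \<nu> (V - E) \<le> ennreal C * emeasure lborel (V - E)"
    using V E(1) by (intro \<nu>) auto
  also have "\<dots> \<le> ennreal C * ennreal (e / C)"
    using V by (intro mult_left_mono) auto
  also have "\<dots> = ennreal e"
    using C \<open>0 < e\<close> by (simp flip: ennreal_mult)
  finally show "emeasure \<mu> E \<le> emeasure \<nu> E + ennreal e" by simp
qed

section \<open>Stieltjes measures of monotone Lipschitz functions\<close>

lemma emeasure_interval_measure_Ioo:
  assumes "a \<le> b" and mono_F: "\<And>x y. x \<le> y \<Longrightarrow> F x \<le> F y"
    and cont_F: "continuous_on UNIV F"
  shows "emeasure (interval_measure F) {a<..<b} = ennreal (F b - F a)"
proof (cases "a = b")
  case False
  have b: "emeasure (interval_measure F) {b} = 0"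
    using emeasure_interval_measure_Icc[OF order_refl mono_F cont_F, of b] by simp
  have "emeasure (interval_measure F) {a<..b} = ennreal (F b - F a)"
    using cont_F assms by (intro emeasure_interval_measure_Ioc)
      (auto intro: mono_F continuous_within_subset simp: continuous_on_eq_continuous_within)
  moreover have "{a<..b} = {a<..<b} \<union> {b}" using False assms by auto
  then have "emeasure (interval_measure F) {a<..b} =
    emeasure (interval_measure F) {a<..<b} + emeasure (interval_measure F) {b}"
    by (simp only:) (intro plus_emeasure[symmetric], auto)
  ultimately show ?thesis using b by simp
qed simp

text \<open>The complement \<open>H x = x - G x\<close> is monotone as well, and the measures of G
  and H add up to Lebesgue measure because they do so on boxes; a summand is at most the
  sum.\<close>

lemma interval_measure_le_lborel:
  fixes G :: "real \<Rightarrow> real"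
  assumes mono_G: "\<And>x y. x \<le> y \<Longrightarrow> G x \<le> G y"
    and Lip: "\<And>x y. x \<le> y \<Longrightarrow> G y - G x \<le> y - x"
    and A: "A \<in> sets borel"
  shows "emeasure (interval_measure G) A \<le> emeasure lborel A"
proof -
  have "1-lipschitz_on UNIV G"
    by (rule lipschitz_on_leI) (use assms in \<open>auto simp: dist_real_def\<close>)
  then have cont: "continuous_on UNIV G" by (rule lipschitz_on_continuous_on)
  define H where "H x = x - G x" for x
  have mono_H: "\<And>x y. x \<le> y \<Longrightarrow> H x \<le> H y" using Lip by (simp add: H_def algebra_simps)
  have cont_H: "continuous_on UNIV H" unfolding H_def by (intro continuous_intros cont)
  define S where "S = measure_of UNIV (sets borel)
    (\<lambda>A. emeasure (interval_measure G) A + emeasure (interval_measure H) A)"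
  have sets_S: "sets S = sets borel"
    unfolding S_def by (subst sets_measure_of) (auto simp: sets.sigma_sets_eq[of borel, simplified])
  have S: "emeasure S A = emeasure (interval_measure G) A + emeasure (interval_measure H) A"
    if "A \<in> sets borel" for A
  proof (rule emeasure_measure_of[OF S_def])
    show "countably_additive (sets S)
      (\<lambda>A. emeasure (interval_measure G) A + emeasure (interval_measure H) A)"
      unfolding countably_additive_def sets_S
      by (auto simp: suminf_add[symmetric] suminf_emeasure[symmetric])
  qed (use that sets_S in \<open>auto simp: positive_def\<close>)
  have "lborel = S"
  proof (rule lborel_eqI)
    fix l u :: real
    assume "\<And>b. b \<in> Basis \<Longrightarrow> l \<bullet> b \<le> u \<bullet> b"
    then have "l \<le> u" by simp
    then show "emeasure S (box l u) = ennreal (\<Prod>b\<in>Basis. (u - l) \<bullet> b)"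
      using mono_G mono_H
      by (simp add: S emeasure_interval_measure_Ioo[OF _ mono_G cont]
        emeasure_interval_measure_Ioo[OF _ mono_H cont_H] box_real flip: ennreal_plus)
       (simp add: H_def)
  qed (simp add: sets_S)
  then have "emeasure lborel A = emeasure S A" by simp
  then show ?thesis using S[OF A] by simp
qed

section \<open>Oscillation of difference quotients\<close>

definition diff_quot :: "('a::real_vector \<Rightarrow> real) \<Rightarrow> 'a \<Rightarrow> 'a \<Rightarrow> real \<Rightarrow> real" where
  "diff_quot f v x h = (f (x + h *\<^sub>R v) - f x) / h"

text \<open>For rational p < q these sets exhaust the points where bounded quotients have no limit
  at 0, so countably many null sets have to be controlled.\<close>

definition oscillation_set ::
  "('a::real_vector \<Rightarrow> real) \<Rightarrow> 'a \<Rightarrow> real \<Rightarrow> real \<Rightarrow> 'a set" where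
  "oscillation_set f v p q =
    {x. (\<exists>\<^sub>F h in at 0. diff_quot f v x h < p) \<and> (\<exists>\<^sub>F h in at 0. q < diff_quot f v x h)}"

lemma frequently_at_0_real:
  "(\<exists>\<^sub>F h in at (0::real). P h) \<longleftrightarrow> (\<forall>n. \<exists>h\<in>{h. h \<noteq> 0 \<and> \<bar>h\<bar> < inverse (real (Suc n))}. P h)"
  (is "?L \<longleftrightarrow> ?R")
proof
  assume L: ?L show ?R
  proof
    fix n
    show "\<exists>h\<in>{h. h \<noteq> 0 \<and> \<bar>h\<bar> < inverse (real (Suc n))}. P h"
      using L[unfolded frequently_at, rule_format, of "inverse (real (Suc n))"]
      by (auto simp: dist_real_def)
  qed
next
  assume R: ?R
  show ?L unfolding frequently_at
  proof (intro allI impI)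
    fix d :: real assume "0 < d"
    then obtain n where "inverse (real (Suc n)) < d" using reals_Archimedean by blast
    moreover obtain h where "h \<noteq> 0" "\<bar>h\<bar> < inverse (real (Suc n))" "P h" using R by blast
    ultimately show "\<exists>x\<in>UNIV. x \<noteq> 0 \<and> dist x 0 < d \<and> P x"
      by (intro bexI[of _ h]) (auto simp: dist_real_def)
  qed
qed

lemma continuous_on_diff_quot:
  fixes f :: "'a::real_normed_vector \<Rightarrow> real"
  assumes "continuous_on UNIV f"
  shows "continuous_on UNIV (\<lambda>x. diff_quot f v x h)"
proof -
  have "continuous_on UNIV (\<lambda>x. f (x + h *\<^sub>R v))"
    by (intro continuous_on_compose2[OF assms] continuous_intros) auto
  then show ?thesis
    unfolding diff_quot_def divide_inverse by (intro continuous_intros assms)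
qed

text \<open>The union over h is uncountable, but its members are open because the quotient is
  continuous in x for fixed h. Only the scales 1 / (n + 1) are intersected, which leaves a countable
  intersection of open sets.\<close>

lemma oscillation_set_borel:
  fixes f :: "'a::real_normed_vector \<Rightarrow> real"
  assumes f: "continuous_on UNIV f"
  shows "oscillation_set f v p q \<in> sets borel"
proof -
  let ?H = "\<lambda>n. {h. h \<noteq> 0 \<and> \<bar>h\<bar> < inverse (real (Suc n))}"
  note c = continuous_on_diff_quot[OF f]
  have "oscillation_set f v p q =
    (\<Inter>n. \<Union>h\<in>?H n. {x. diff_quot f v x h < p}) \<inter> (\<Inter>n. \<Union>h\<in>?H n. {x. q < diff_quot f v x h})"
    unfolding oscillation_set_def frequently_at_0_real by auto
  also have "\<dots> \<in> sets borel"
  proof -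
    have "(\<Union>h\<in>?H n. {x. diff_quot f v x h < p}) \<in> sets borel"
      "(\<Union>h\<in>?H n. {x. q < diff_quot f v x h}) \<in> sets borel" for n
      by (intro borel_open open_UN ballI open_Collect_less continuous_on_const c)+
    then show ?thesis by (intro sets.Int sets.countable_INT'') simp_all
  qed
  finally show ?thesis .
qed

text \<open>
  With \<open>\<mu>\<close> the Stieltjes measure of the normalised function and \<open>E\<close> the oscillation set, the Vitali
  comparison gives \<open>q' |E| \<le> \<mu> E \<le> p' |E|\<close> with \<open>p' < q'\<close>.
\<close>

lemma oscillation_set_real_null:
  fixes F :: "real \<Rightarrow> real"
  assumes F: "K-lipschitz_on UNIV F" and pq: "p < q"
  shows "oscillation_set F 1 p q \<in> null_sets lborel"
proof -
  \<comment> \<open>The added 1 keeps M positive for constant F, so that division by 2 * M is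
    harmless.\<close>
  define M where "M = K + 1"
  have "0 \<le> K" using F by (rule lipschitz_on_nonneg)
  then have M: "0 < M" "K \<le> M" by (auto simp: M_def)
  have LipF: "\<bar>F y - F x\<bar> \<le> M * \<bar>y - x\<bar>" for x y
    using lipschitz_onD[OF lipschitz_on_mono[OF F order_refl M(2)], of y x] by (simp add: dist_real_def)
  \<comment> \<open>Slopes of F in [-M, M] are mapped affinely to slopes of G in [0, 1];
    \<open>p'\<close> and \<open>q'\<close> below are the images of p and q.\<close>
  define G where "G t = (F t + M * t) / (2 * M)" for t
  have mono_G: "G x \<le> G y" if "x \<le> y" for x y
    using LipF[of y x] that M by (auto simp: G_def algebra_simps divide_right_mono)
  have Lip_G: "G y - G x \<le> y - x" if "x \<le> y" for x y
  proof -
    have "G y - G x = (F y - F x + M * (y - x)) / (2 * M)"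
      by (simp add: G_def diff_divide_distrib[symmetric] algebra_simps)
    also have "\<dots> \<le> (M * (y - x) + M * (y - x)) / (2 * M)"
      using LipF[of y x] that M by (intro divide_right_mono) auto
    also have "\<dots> = y - x" using M by (simp add: field_simps)
    finally show ?thesis .
  qed
  have "1-lipschitz_on UNIV G"
    by (rule lipschitz_on_leI) (use mono_G Lip_G in \<open>auto simp: dist_real_def\<close>)
  then have cont: "continuous_on UNIV G" by (rule lipschitz_on_continuous_on)
  define p' q' where "p' = (p + M) / (2 * M)" and "q' = (q + M) / (2 * M)"
  have pq': "p' < q'" using pq M by (simp add: p'_def q'_def divide_strict_right_mono)
  define \<mu> where "\<mu> = interval_measure G"
  have \<mu>: "emeasure \<mu> {a..b} = ennreal (G b - G a)" if "a \<le> b" for a b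
    unfolding \<mu>_def by (rule emeasure_interval_measure_Icc[OF that mono_G cont])
  have [simp]: "sets \<mu> = sets borel" by (simp add: \<mu>_def)
  have incr: "\<exists>a b. a \<le> x \<and> x \<le> b \<and> a < b \<and> b - a = \<bar>h\<bar> \<and>
      emeasure \<mu> {a..b} = ennreal ((diff_quot F 1 x h + M) / (2 * M) * \<bar>h\<bar>)
      \<and> 0 \<le> (diff_quot F 1 x h + M) / (2 * M)"
    if h: "h \<noteq> 0" for x h
  proof -
    have quot: "(diff_quot F 1 x h + M) / (2 * M) = (G (x + h) - G x) / h"
      using h M by (simp add: G_def diff_quot_def field_simps)
    show ?thesis
    proof (cases "0 < h")
      case True
      then show ?thesis using mono_G[of x "x + h"] unfolding quot
        by (intro exI[of _ x] exI[of _ "x + h"]) (auto simp: \<mu>)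
    next
      case False
      with h have "h < 0" by simp
      then show ?thesis using mono_G[of "x + h" x] unfolding quot
        by (intro exI[of _ "x + h"] exI[of _ x]) (auto simp: \<mu> divide_nonpos_neg)
    qed
  qed
  \<comment> \<open>Cutting to a bounded interval makes the measure finite, so that it can be
    cancelled at the end.\<close>
  have null: "oscillation_set F 1 p q \<inter> {-real R..real R} \<in> null_sets lborel" for R
  proof -
    define E where "E = oscillation_set F 1 p q \<inter> {-real R..real R}"
    have E: "E \<in> sets borel"
      using oscillation_set_borel[OF lipschitz_on_continuous_on[OF F], of 1 p q] by (simp add: E_def)
    have "emeasure lborel E \<le> emeasure lborel {-real R..real R}"
      by (intro emeasure_mono) (auto simp: E_def)
    then have fin: "emeasure lborel E < \<infinity>" by (rule le_less_trans) simp
    have Ep: "\<exists>h. h \<noteq> 0 \<and> \<bar>h\<bar> < d \<and> diff_quot F 1 x h < p"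
      and Eq: "\<exists>h. h \<noteq> 0 \<and> \<bar>h\<bar> < d \<and> q < diff_quot F 1 x h" if "x \<in> E" "0 < d" for x d
      using that by (auto simp: E_def oscillation_set_def frequently_at dist_real_def)
    \<comment> \<open>One constant that dominates \<mu> (through the summand 1) and both multiples
      of Lebesgue measure.\<close>
    define C where "C = 1 + \<bar>p'\<bar> + \<bar>q'\<bar>"
    have C: "0 < C" "1 \<le> C" "p' \<le> C" "q' \<le> C" by (auto simp: C_def)
    have \<mu>_le: "emeasure \<mu> A \<le> ennreal C * emeasure lborel A" if "A \<in> sets borel" for A
    proof -
      have "emeasure \<mu> A \<le> 1 * emeasure lborel A"
        unfolding \<mu>_def by (simp add: interval_measure_le_lborel[OF mono_G Lip_G that])
      also have "\<dots> \<le> ennreal C * emeasure lborel A"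
        using C by (intro mult_right_mono) auto
      finally show ?thesis .
    qed
    have scale_le: "emeasure (scale_measure (ennreal r) lborel) A \<le> ennreal C * emeasure lborel A"
      if "r \<le> C" for r and A :: "real set"
      using that by (auto intro!: mult_right_mono ennreal_leI)
    have "emeasure \<mu> E \<le> emeasure (scale_measure (ennreal p') lborel) E"
    proof (rule vitali_emeasure_le[OF _ _ \<mu>_le scale_le])
      fix x d :: real assume x: "x \<in> E" "0 < d"
      obtain h where h: "h \<noteq> 0" "\<bar>h\<bar> < d" "diff_quot F 1 x h < p" using Ep[OF x] by auto
      have "(diff_quot F 1 x h + M) / (2 * M) \<le> p'"
        unfolding p'_def using h M by (intro divide_right_mono) auto
      then have le: "ennreal ((diff_quot F 1 x h + M) / (2 * M) * \<bar>h\<bar>) \<le> ennreal p' * ennreal \<bar>h\<bar>"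
        by (subst ennreal_mult''[symmetric]) (rule abs_ge_zero, intro ennreal_leI mult_right_mono, simp_all)
      from incr[OF h(1), of x] obtain a b where "a \<le> x" "x \<le> b" "a < b" "b - a = \<bar>h\<bar>"
        "emeasure \<mu> {a..b} = ennreal ((diff_quot F 1 x h + M) / (2 * M) * \<bar>h\<bar>)" by blast
      with le h show "\<exists>a b. a \<le> x \<and> x \<le> b \<and> a < b \<and> b - a < d \<and>
          emeasure \<mu> {a..b} \<le> emeasure (scale_measure (ennreal p') lborel) {a..b}"
        by (intro exI[of _ a] exI[of _ b]) auto
    qed (use C E fin in auto)
    moreover have "emeasure (scale_measure (ennreal q') lborel) E \<le> emeasure \<mu> E"
    proof (rule vitali_emeasure_le[OF _ _ scale_le \<mu>_le])
      fix x d :: real assume x: "x \<in> E" "0 < d"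
      obtain h where h: "h \<noteq> 0" "\<bar>h\<bar> < d" "q < diff_quot F 1 x h" using Eq[OF x] by auto
      have "q' \<le> (diff_quot F 1 x h + M) / (2 * M)"
        unfolding q'_def using h M by (intro divide_right_mono) auto
      then have le: "ennreal q' * ennreal \<bar>h\<bar> \<le> ennreal ((diff_quot F 1 x h + M) / (2 * M) * \<bar>h\<bar>)"
        by (subst ennreal_mult''[symmetric]) (rule abs_ge_zero, intro ennreal_leI mult_right_mono, simp_all)
      from incr[OF h(1), of x] obtain a b where "a \<le> x" "x \<le> b" "a < b" "b - a = \<bar>h\<bar>"
        "emeasure \<mu> {a..b} = ennreal ((diff_quot F 1 x h + M) / (2 * M) * \<bar>h\<bar>)" by blast
      with le h show "\<exists>a b. a \<le> x \<and> x \<le> b \<and> a < b \<and> b - a < d \<and>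
          emeasure (scale_measure (ennreal q') lborel) {a..b} \<le> emeasure \<mu> {a..b}"
        by (intro exI[of _ a] exI[of _ b]) auto
    qed (use C E fin in auto)
    ultimately have le: "ennreal q' * emeasure lborel E \<le> ennreal p' * emeasure lborel E" by simp
    have "emeasure lborel E = 0"
    proof (cases "E = {}")
      case False
      then obtain x where "x \<in> E" by auto
      then obtain h where h: "h \<noteq> 0" "diff_quot F 1 x h < p" using Ep[of x 1] by auto
      \<comment> \<open>\<open>ennreal\<close> truncates at 0, so the sign of \<open>p'\<close>
        matters: a point of E has a nonnegative normalized quotient below \<open>p'\<close>.\<close>
      have "0 \<le> (diff_quot F 1 x h + M) / (2 * M)" using incr[OF h(1)] by blast
      also have "\<dots> < p'" unfolding p'_def using h M by (intro divide_strict_right_mono) auto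
      finally have p': "0 < p'" .
      obtain m where m: "0 \<le> m" "emeasure lborel E = ennreal m"
        using fin by (cases "emeasure lborel E") auto
      have "q' * m \<le> p' * m"
        using le p' pq' m by (simp flip: ennreal_mult)
      then have "m = 0" using m(1) pq' by (metis linorder_not_less mult_strict_right_mono order_le_less)
      then show ?thesis using m by simp
    qed simp
    then show ?thesis using E unfolding E_def[symmetric] by (simp add: null_sets_def)
  qed
  have "(\<Union>R. oscillation_set F 1 p q \<inter> {-real R..real R}) \<in> null_sets lborel"
    by (rule null_sets_UN[OF null])
  also have "(\<Union>R. oscillation_set F 1 p q \<inter> {-real R..real R}) = oscillation_set F 1 p q"
  proof -
    have "\<exists>R. x \<in> {-real R..real R}" for x :: real
      using real_arch_simple[of "\<bar>x\<bar>"] by (auto simp: abs_le_iff minus_le_iff)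
    then show ?thesis by blast
  qed
  finally show ?thesis .
qed

lemma lipschitz_on_along_line:
  fixes f :: "'a::real_normed_vector \<Rightarrow> real"
  assumes f: "K-lipschitz_on UNIV f"
  shows "(K * norm v)-lipschitz_on UNIV (\<lambda>t. f (x + t *\<^sub>R v))"
proof (rule lipschitz_onI)
  fix s t :: real
  have "dist (f (x + s *\<^sub>R v)) (f (x + t *\<^sub>R v)) \<le> K * dist (x + s *\<^sub>R v) (x + t *\<^sub>R v)"
    by (rule lipschitz_onD[OF f]) auto
  also have "dist (x + s *\<^sub>R v) (x + t *\<^sub>R v) = norm v * dist s t"
    by (simp add: dist_norm scaleR_left_diff_distrib[symmetric])
  finally show "dist (f (x + s *\<^sub>R v)) (f (x + t *\<^sub>R v)) \<le> K * norm v * dist s t"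
    by (simp add: mult.assoc)
qed (use lipschitz_on_nonneg[OF f] in auto)

lemma nn_integral_lborel_shift:
  fixes c :: "'a::euclidean_space"
  assumes [measurable]: "u \<in> borel_measurable borel"
  shows "(\<integral>\<^sup>+x. u (x + c) \<partial>lborel) = (\<integral>\<^sup>+x. u x \<partial>lborel)"
  by (subst (2) lborel_distr_plus[of c, symmetric], subst nn_integral_distr)
     (auto simp: add.commute)

text \<open>
  No rotation of coordinates is needed: averaging the null sections along \<open>v\<close> over \<open>t \<in> [0, 1]\<close>
  and exchanging integrals returns the measure of the set itself, by translation invariance.
\<close>

lemma oscillation_set_null:
  fixes f :: "'a::euclidean_space \<Rightarrow> real"
  assumes f: "K-lipschitz_on UNIV f" and pq: "p < q"
  shows "oscillation_set f v p q \<in> null_sets lborel"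
proof -
  define B where "B = oscillation_set f v p q"
  have B[measurable]: "B \<in> sets borel"
    unfolding B_def by (rule oscillation_set_borel[OF lipschitz_on_continuous_on[OF f]])
  let ?i = "\<lambda>x t. indicator B (x + t *\<^sub>R v) * indicator {0..1::real} t :: ennreal"
  have line: "(\<integral>\<^sup>+t. ?i x t \<partial>lborel) = 0" for x
  proof -
    have "diff_quot f v (x + t *\<^sub>R v) h = diff_quot (\<lambda>t. f (x + t *\<^sub>R v)) 1 t h" for t h
      by (simp add: diff_quot_def algebra_simps)
    then have "{t. x + t *\<^sub>R v \<in> B} = oscillation_set (\<lambda>t. f (x + t *\<^sub>R v)) 1 p q"
      by (simp add: B_def oscillation_set_def)
    with oscillation_set_real_null[OF lipschitz_on_along_line[OF f] pq]
    have "{t. x + t *\<^sub>R v \<in> B} \<in> null_sets lborel" by simp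
    then have "AE t in lborel. ?i x t = 0"
      by (rule AE_I') (auto simp: indicator_def)
    then show ?thesis by (simp add: nn_integral_0_iff_AE)
  qed
  have "emeasure lborel B = (\<integral>\<^sup>+t. emeasure lborel B * indicator {0..1::real} t \<partial>lborel)"
    by (simp add: nn_integral_cmult)
  also have "\<dots> = (\<integral>\<^sup>+t. (\<integral>\<^sup>+x. ?i x t \<partial>lborel) \<partial>lborel)"
    by (intro nn_integral_cong)
       (simp add: nn_integral_multc nn_integral_lborel_shift[of "indicator B"])
  also have "\<dots> = (\<integral>\<^sup>+x. (\<integral>\<^sup>+t. ?i x t \<partial>lborel) \<partial>lborel)"
    by (rule lborel_pair.Fubini') (simp add: split_beta')
  also have "\<dots> = 0" by (simp add: line)
  finally show ?thesis using B by (simp add: null_sets_def B_def)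
qed

text \<open>The limit is the limit superior, written as the infimum of the eventual upper bounds. If
  u were frequently at most some c below it, u would oscillate across rationals p < q chosen between
  c and the infimum.\<close>

lemma bounded_no_oscillation_tendsto:
  fixes u :: "'a \<Rightarrow> real"
  assumes bnd: "\<forall>\<^sub>F h in F. \<bar>u h\<bar> \<le> B" and F: "F \<noteq> bot"
    and osc: "\<And>p q. p \<in> \<rat> \<Longrightarrow> q \<in> \<rat> \<Longrightarrow> p < q \<Longrightarrow>
      \<not> ((\<exists>\<^sub>F h in F. u h < p) \<and> (\<exists>\<^sub>F h in F. q < u h))"
  shows "\<exists>l. (u \<longlongrightarrow> l) F"
proof -
  define S where "S = {c. \<forall>\<^sub>F h in F. u h \<le> c}"
  have "B \<in> S" using bnd unfolding S_def by (auto elim: eventually_mono)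
  have low: "- B \<le> c" if "c \<in> S" for c
  proof -
    have "\<forall>\<^sub>F h in F. - B \<le> c"
      using bnd that[unfolded S_def, simplified] by eventually_elim auto
    then show ?thesis using F by auto
  qed
  then have bdd: "bdd_below S" by (rule bdd_belowI)
  have "(u \<longlongrightarrow> Inf S) F"
  proof (rule order_tendstoI)
    fix c assume "Inf S < c"
    then obtain s where "s \<in> S" "s < c" using cInf_lessD[of S c] \<open>B \<in> S\<close> by auto
    then show "\<forall>\<^sub>F h in F. u h < c" unfolding S_def by (auto elim: eventually_mono)
  next
    fix c assume "c < Inf S"
    then obtain q where q: "q \<in> \<rat>" "c < q" "q < Inf S" using Rats_dense_in_real by blast
    then obtain p where p: "p \<in> \<rat>" "c < p" "p < q" using Rats_dense_in_real by blast
    have "q \<notin> S" using q(3) bdd cInf_lower by force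
    then have "\<exists>\<^sub>F h in F. q < u h" by (auto simp: S_def not_eventually not_le)
    then have "\<not> (\<exists>\<^sub>F h in F. u h < p)" using osc p q by blast
    then show "\<forall>\<^sub>F h in F. c < u h"
      using p(2) by (auto simp: not_frequently not_less elim: eventually_mono)
  qed
  then show ?thesis by blast
qed

lemma diff_quot_bound:
  fixes f :: "'a::real_normed_vector \<Rightarrow> real"
  assumes f: "K-lipschitz_on UNIV f"
  shows "\<bar>diff_quot f v x h\<bar> \<le> K * norm v"
proof (cases "h = 0")
  case False
  have "\<bar>f (x + h *\<^sub>R v) - f x\<bar> \<le> K * (\<bar>h\<bar> * norm v)"
    using lipschitz_onD[OF f, of "x + h *\<^sub>R v" x] by (simp add: dist_norm)
  then show ?thesis using False by (simp add: diff_quot_def field_simps)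
qed (use lipschitz_on_nonneg[OF f] in \<open>simp add: diff_quot_def\<close>)

lemma lipschitz_AE_directional_derivative:
  fixes f :: "'a::euclidean_space \<Rightarrow> real"
  assumes f: "K-lipschitz_on UNIV f"
  shows "AE x in lborel. \<exists>l. (diff_quot f v x \<longlongrightarrow> l) (at 0)"
proof -
  have "AE x in lborel. \<forall>p\<in>\<rat>. \<forall>q\<in>\<rat>. p < q \<longrightarrow> x \<notin> oscillation_set f v p q"
    unfolding AE_ball_countable[OF countable_rat]
    using AE_not_in[OF oscillation_set_null[OF f]] by auto
  then show ?thesis
  proof eventually_elim
    case (elim x)
    show ?case
      by (rule bounded_no_oscillation_tendsto[where B = "K * norm v"])
         (use elim diff_quot_bound[OF f] in \<open>auto simp: oscillation_set_def\<close>)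
  qed
qed

subsection \<open>Rademacher's theorem\<close>

text \<open>The limit along 1 / (n + 1) gives a total function whose measurability is that of a
  sequential limit; it agrees with the two-sided derivative wherever that exists.\<close>

definition dir_deriv :: "('a::real_normed_vector \<Rightarrow> real) \<Rightarrow> 'a \<Rightarrow> 'a \<Rightarrow> real" where
  "dir_deriv f v x = lim (\<lambda>n. diff_quot f v x (inverse (real (Suc n))))"

lemma filterlim_inverse_Suc_at_0:
  "filterlim (\<lambda>n. inverse (real (Suc n))) (at 0) sequentially"
  using LIMSEQ_inverse_real_of_nat by (simp add: filterlim_at)

lemma dir_deriv_eqI:
  assumes "(diff_quot f v x \<longlongrightarrow> l) (at 0)"
  shows "dir_deriv f v x = l"
  unfolding dir_deriv_def
  by (rule limI) (rule filterlim_compose[OF assms filterlim_inverse_Suc_at_0])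

lemma lipschitz_AE_tendsto_dir_deriv:
  fixes f :: "'a::euclidean_space \<Rightarrow> real"
  assumes "K-lipschitz_on UNIV f"
  shows "AE x in lborel. (diff_quot f v x \<longlongrightarrow> dir_deriv f v x) (at 0)"
  using lipschitz_AE_directional_derivative[OF assms, of v]
  by eventually_elim (use dir_deriv_eqI in metis)

lemma borel_measurable_diff_quot:
  fixes f :: "'a::euclidean_space \<Rightarrow> real"
  assumes "K-lipschitz_on UNIV f"
  shows "(\<lambda>x. diff_quot f v x h) \<in> borel_measurable borel"
  by (intro borel_measurable_continuous_onI continuous_on_diff_quot
      lipschitz_on_continuous_on[OF assms])

lemma borel_measurable_dir_deriv:
  fixes f :: "'a::euclidean_space \<Rightarrow> real"
  assumes "K-lipschitz_on UNIV f"
  shows "dir_deriv f v \<in> borel_measurable borel"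
  unfolding dir_deriv_def using borel_measurable_diff_quot[OF assms]
  by (intro borel_measurable_lim_metric)

lemma tendsto_dir_deriv_bound:
  fixes f :: "'a::euclidean_space \<Rightarrow> real"
  assumes f: "K-lipschitz_on UNIV f" and "(diff_quot f v x \<longlongrightarrow> l) (at 0)"
  shows "\<bar>l\<bar> \<le> K * norm v"
  by (rule tendsto_upperbound[OF tendsto_rabs[OF assms(2)]])
     (auto intro: always_eventually diff_quot_bound[OF f])

text \<open>\<open>1 + u / c\<close> is almost everywhere nonnegative and thus a density. By
  hypothesis the measure it defines gives boxes their volume, so it is Lebesgue measure, and
  uniqueness of densities yields u = 0.\<close>

lemma AE_eq_0_of_box_integrals:
  fixes u :: "'a::euclidean_space \<Rightarrow> real"
  assumes [measurable]: "u \<in> borel_measurable borel"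
    and bnd: "AE x in lborel. \<bar>u x\<bar> \<le> c" and c: "0 < c"
    and box: "\<And>a b. (\<integral>x. indicator (box a b) x * u x \<partial>lborel) = 0"
  shows "AE x in lborel. u x = 0"
proof -
  let ?w = "\<lambda>x. ennreal (1 + u x / c)"
  have "lborel = density lborel ?w"
  proof (rule lborel_eqI)
    fix a b :: 'a assume ab: "\<And>i. i \<in> Basis \<Longrightarrow> a \<bullet> i \<le> b \<bullet> i"
    have fin: "emeasure lborel (box a b) < \<infinity>"
      using ab by (simp add: emeasure_lborel_box_eq)
    have int1: "integrable lborel (indicator (box a b) :: 'a \<Rightarrow> real)"
      using fin by (intro integrable_real_indicator) auto
    have intu: "integrable lborel (\<lambda>x. indicator (box a b) x * u x)"
    proof (rule Bochner_Integration.integrable_bound)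
      show "integrable lborel (\<lambda>x. indicator (box a b) x * c)" using int1 by simp
      show "AE x in lborel. norm (indicator (box a b) x * u x) \<le> norm (indicator (box a b) x * c)"
        using bnd by eventually_elim (auto simp: indicator_def)
    qed simp
    have "emeasure (density lborel ?w) (box a b) =
      (\<integral>\<^sup>+x. ennreal (indicator (box a b) x + (indicator (box a b) x * u x) / c) \<partial>lborel)"
      by (subst emeasure_density) (auto intro!: nn_integral_cong simp: indicator_def)
    also have "\<dots> = ennreal (\<integral>x. indicator (box a b) x + (indicator (box a b) x * u x) / c \<partial>lborel)"
    proof (rule nn_integral_eq_integral)
      show "AE x in lborel. 0 \<le> indicator (box a b) x + (indicator (box a b) x * u x) / c"
        using bnd
      proof eventually_elim
        case (elim x)
        then have "-1 \<le> u x / c" using c by (simp add: field_simps)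
        then show ?case by (simp add: indicator_def)
      qed
    qed (use int1 intu in auto)
    also have "\<dots> = ennreal (measure lborel (box a b))"
      using int1 intu box[of a b] by (subst Bochner_Integration.integral_add) auto
    finally show "emeasure (density lborel ?w) (box a b) = ennreal (\<Prod>i\<in>Basis. (b - a) \<bullet> i)"
      using ab by (simp add: measure_lborel_box_eq)
  qed simp
  then have "density lborel (\<lambda>_. 1 :: ennreal) = density lborel ?w"
    by (simp add: density_1)
  then have "AE x in lborel. 1 = ?w x"
    by (intro sigma_finite_measure.density_unique[OF sigma_finite_lborel]) simp_all
  then show ?thesis
  proof eventually_elim
    case (elim x)
    then have "1 + u x / c = 1" by (simp add: ennreal_eq_1)
    then show ?case using c by simp
  qed
qed

lemma integral_lborel_shift:
  fixes c :: "'a::euclidean_space" and u :: "'a \<Rightarrow> real"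
  assumes [measurable]: "u \<in> borel_measurable borel"
  shows "(\<integral>x. u (x + c) \<partial>lborel) = (\<integral>x. u x \<partial>lborel)"
  by (subst (2) lborel_distr_plus[of c, symmetric], subst integral_distr)
     (auto simp: add.commute)

lemma integrable_indicator_mult_bounded:
  fixes u :: "'a::euclidean_space \<Rightarrow> real"
  assumes [measurable]: "u \<in> borel_measurable borel" "A \<in> sets borel"
    and "bounded A" and u: "\<And>x. \<bar>u x\<bar> \<le> c"
  shows "integrable lborel (\<lambda>x. indicator A x * u x)"
proof (rule Bochner_Integration.integrable_bound)
  show "integrable lborel (\<lambda>x. indicator A x * c)"
    using emeasure_bounded_finite[OF \<open>bounded A\<close>] by (simp add: less_top)
  have "0 \<le> c" using u[of undefined] by linarith
  then show "AE x in lborel. norm (indicator A x * u x) \<le> norm (indicator A x * c)"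
    using u by (auto simp: indicator_def)
qed simp

lemma tendsto_indicator_off_frontier:
  assumes "x \<notin> frontier B" and X: "X \<longlonglongrightarrow> x"
  shows "(\<lambda>n. indicator B (X n) :: real) \<longlonglongrightarrow> indicator B x"
proof (cases "x \<in> interior B")
  case True
  then have "\<forall>\<^sub>F n in sequentially. X n \<in> interior B"
    using X by (intro topological_tendstoD) auto
  then have "\<forall>\<^sub>F n in sequentially. indicator B (X n) = (indicator B x :: real)"
    by eventually_elim (use True interior_subset in \<open>fastforce simp: indicator_def\<close>)
  then show ?thesis by (rule tendsto_eventually)
next
  case False
  then have x: "x \<in> - closure B" using assms by (simp add: frontier_def)
  then have "\<forall>\<^sub>F n in sequentially. X n \<in> - closure B"
    using X by (intro topological_tendstoD) auto
  then have "\<forall>\<^sub>F n in sequentially. indicator B (X n) = (indicator B x :: real)"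
    by eventually_elim (use x closure_subset in \<open>fastforce simp: indicator_def\<close>)
  then show ?thesis by (rule tendsto_eventually)
qed

text \<open>
  Additivity in the direction is tested against boxes: translating the box by \<open>v / n\<close>
  splits the difference quotient in direction \<open>v + w\<close>, and the translated indicators
  converge almost everywhere because the boundary of a box is a null set.
\<close>

lemma lipschitz_AE_dir_deriv_add:
  fixes f :: "'a::euclidean_space \<Rightarrow> real"
  assumes f: "K-lipschitz_on UNIV f"
  shows "AE x in lborel. dir_deriv f (v + w) x = dir_deriv f v x + dir_deriv f w x"
proof -
  define s where "s n = inverse (real (Suc n))" for n
  have s: "0 < s n" "s n \<le> 1" for n by (simp_all add: s_def field_simps)
  have s0: "s \<longlonglongrightarrow> 0" unfolding s_def by (rule LIMSEQ_inverse_real_of_nat)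
  note [measurable] = borel_measurable_diff_quot[OF f] borel_measurable_dir_deriv[OF f]
  have lim: "AE x in lborel. (\<lambda>n. diff_quot f v x (s n)) \<longlonglongrightarrow> dir_deriv f v x" for v
    using lipschitz_AE_tendsto_dir_deriv[OF f, of v] unfolding s_def
    by eventually_elim (rule filterlim_compose[OF _ filterlim_inverse_Suc_at_0])
  have D: "AE x in lborel. \<bar>dir_deriv f v x\<bar> \<le> K * norm v" for v
    using lipschitz_AE_tendsto_dir_deriv[OF f, of v]
    by eventually_elim (rule tendsto_dir_deriv_bound[OF f])
  have K: "0 \<le> K" using f by (rule lipschitz_on_nonneg)
  define c where "c = K * norm (v + w) + K * norm v + K * norm w + 1"
  have "AE x in lborel. dir_deriv f (v + w) x - dir_deriv f v x - dir_deriv f w x = 0"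
  proof (rule AE_eq_0_of_box_integrals)
    show "AE x in lborel. \<bar>dir_deriv f (v + w) x - dir_deriv f v x - dir_deriv f w x\<bar> \<le> c"
      using D[of "v + w"] D[of v] D[of w] by eventually_elim (simp add: c_def)
    show "0 < c" using K by (simp add: c_def add_nonneg_pos)
    fix a b :: 'a
    define B where "B = box a b"
    have [measurable]: "B \<in> sets borel" by (simp add: B_def)
    have "bounded B" unfolding B_def by (rule bounded_box)
    then obtain R where R: "\<And>x. x \<in> B \<Longrightarrow> norm x \<le> R" by (auto simp: bounded_iff)
    have int_ind: "integrable lborel (\<lambda>x. indicator A x * r)" if "bounded A" "A \<in> sets borel"
      for A :: "'a set" and r :: real
      using that by (intro integrable_indicator_mult_bounded[where c = "\<bar>r\<bar>"]) auto
    have lim1: "(\<lambda>n. \<integral>x. indicator B x * diff_quot f v x (s n) \<partial>lborel)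
        \<longlonglongrightarrow> (\<integral>x. indicator B x * dir_deriv f v x \<partial>lborel)"
      and intD: "integrable lborel (\<lambda>x. indicator B x * dir_deriv f v x)" for v
    proof -
      have 1: "AE x in lborel. (\<lambda>n. indicator B x * diff_quot f v x (s n))
          \<longlonglongrightarrow> indicator B x * dir_deriv f v x"
        using lim[of v] by eventually_elim (intro tendsto_intros)
      have 2: "AE x in lborel. norm (indicator B x * diff_quot f v x (s n))
          \<le> indicator B x * (K * norm v)" for n
        using diff_quot_bound[OF f] by (auto simp: indicator_def)
      note i = int_ind[OF \<open>bounded B\<close> \<open>B \<in> sets borel\<close>]
      show "(\<lambda>n. \<integral>x. indicator B x * diff_quot f v x (s n) \<partial>lborel)
        \<longlonglongrightarrow> (\<integral>x. indicator B x * dir_deriv f v x \<partial>lborel)"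
        by (rule integral_dominated_convergence[OF _ _ i 1 2]) auto
      show "integrable lborel (\<lambda>x. indicator B x * dir_deriv f v x)"
        by (rule integrable_dominated_convergence[OF _ _ i 1 2]) auto
    qed
    have lim2: "(\<lambda>n. \<integral>x. indicator B (x - s n *\<^sub>R v) * diff_quot f w x (s n) \<partial>lborel)
        \<longlonglongrightarrow> (\<integral>x. indicator B x * dir_deriv f w x \<partial>lborel)"
    proof (rule integral_dominated_convergence)
      \<comment> \<open>All translates of B by \<open>s n *\<^sub>R v\<close> lie in this ball
        because \<open>s n \<le> 1\<close>.\<close>
      show "integrable lborel (\<lambda>x. indicator (cball (0::'a) (R + norm v)) x * (K * norm w))"
        by (rule int_ind) auto
      have "frontier B \<in> null_sets lborel"
        using negligible_convex_frontier[OF convex_box(2), of a b]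
        by (simp add: B_def negligible_iff_null_sets null_sets_def)
      then have "AE x in lborel. x \<notin> frontier B" by (rule AE_not_in)
      then show "AE x in lborel. (\<lambda>n. indicator B (x - s n *\<^sub>R v) * diff_quot f w x (s n))
          \<longlonglongrightarrow> indicator B x * dir_deriv f w x"
        using lim[of w]
      proof eventually_elim
        case (elim x)
        have "(\<lambda>n. x - s n *\<^sub>R v) \<longlonglongrightarrow> x - 0 *\<^sub>R v" by (intro tendsto_intros s0)
        then have "(\<lambda>n. indicator B (x - s n *\<^sub>R v) :: real) \<longlonglongrightarrow> indicator B x"
          using elim by (intro tendsto_indicator_off_frontier) auto
        then show ?case using elim by (intro tendsto_intros)
      qed
      show "AE x in lborel. norm (indicator B (x - s n *\<^sub>R v) * diff_quot f w x (s n))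
          \<le> indicator (cball 0 (R + norm v)) x * (K * norm w)" for n
      proof (rule AE_I2)
        fix x
        show "norm (indicator B (x - s n *\<^sub>R v) * diff_quot f w x (s n))
          \<le> indicator (cball 0 (R + norm v)) x * (K * norm w)"
        proof (cases "x - s n *\<^sub>R v \<in> B")
          case True
          have "norm x \<le> norm (x - s n *\<^sub>R v) + norm (s n *\<^sub>R v)"
            by (metis diff_add_cancel norm_triangle_ineq)
          also have "\<dots> \<le> R + norm v"
            using R[OF True] s[of n] by (intro add_mono) (auto intro: mult_left_le_one_le)
          finally show ?thesis using diff_quot_bound[OF f] True by simp
        qed (use K in simp)
      qed
    qed auto
    \<comment> \<open>After the substitution the quotient in direction w is taken at a fixed point,
      where it converges, and the moving point sits in the indicator.\<close>
    have split: "(\<integral>x. indicator B x * diff_quot f (v + w) x (s n) \<partial>lborel) =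
        (\<integral>x. indicator B x * diff_quot f v x (s n) \<partial>lborel) +
        (\<integral>x. indicator B (x - s n *\<^sub>R v) * diff_quot f w x (s n) \<partial>lborel)" for n
    proof -
      have "diff_quot f (v + w) x (s n) =
          diff_quot f v x (s n) + diff_quot f w (x + s n *\<^sub>R v) (s n)" for x
        by (simp add: diff_quot_def algebra_simps flip: add_divide_distrib diff_divide_distrib)
      then have "(\<integral>x. indicator B x * diff_quot f (v + w) x (s n) \<partial>lborel) =
        (\<integral>x. indicator B x * diff_quot f v x (s n) +
              indicator B x * diff_quot f w (x + s n *\<^sub>R v) (s n) \<partial>lborel)"
        by (simp add: distrib_left)
      also have "\<dots> = (\<integral>x. indicator B x * diff_quot f v x (s n) \<partial>lborel) +
        (\<integral>x. indicator B x * diff_quot f w (x + s n *\<^sub>R v) (s n) \<partial>lborel)"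
        using \<open>bounded B\<close> diff_quot_bound[OF f]
        by (intro Bochner_Integration.integral_add integrable_indicator_mult_bounded) auto
      also have "(\<integral>x. indicator B x * diff_quot f w (x + s n *\<^sub>R v) (s n) \<partial>lborel) =
        (\<integral>x. indicator B (x - s n *\<^sub>R v) * diff_quot f w x (s n) \<partial>lborel)"
        using integral_lborel_shift
          [of "\<lambda>x. indicator B (x - s n *\<^sub>R v) * diff_quot f w x (s n)" "s n *\<^sub>R v"] by simp
      finally show ?thesis .
    qed
    have "(\<integral>x. indicator B x * dir_deriv f (v + w) x \<partial>lborel) =
        (\<integral>x. indicator B x * dir_deriv f v x \<partial>lborel) +
        (\<integral>x. indicator B x * dir_deriv f w x \<partial>lborel)"
      by (rule LIMSEQ_unique[OF lim1]) (unfold split, intro tendsto_add lim1 lim2)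
    then show "(\<integral>x. indicator (box a b) x *
        (dir_deriv f (v + w) x - dir_deriv f v x - dir_deriv f w x) \<partial>lborel) = 0"
      using intD by (simp add: right_diff_distrib B_def)
  qed measurable
  then show ?thesis by eventually_elim simp
qed

lemma tendsto_diff_quot_scale:
  fixes f :: "'a::real_normed_vector \<Rightarrow> real"
  assumes l: "(diff_quot f v x \<longlongrightarrow> l) (at 0)"
  shows "(diff_quot f (c *\<^sub>R v) x \<longlongrightarrow> c * l) (at 0)"
proof (cases "c = 0")
  case True
  then have "diff_quot f (c *\<^sub>R v) x = (\<lambda>h. 0)" by (auto simp: diff_quot_def)
  then show ?thesis using True by simp
next
  case False
  have "((\<lambda>h. c * h) \<longlongrightarrow> c * 0) (at 0)" by (intro tendsto_intros)
  then have "filterlim (\<lambda>h. c * h) (at 0) (at 0)"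
    using False by (auto simp: filterlim_at eventually_at_filter)
  then have "((\<lambda>h. c * diff_quot f v x (c * h)) \<longlongrightarrow> c * l) (at 0)"
    by (intro tendsto_mult tendsto_const filterlim_compose[OF l])
  moreover have "diff_quot f (c *\<^sub>R v) x = (\<lambda>h. c * diff_quot f v x (c * h))"
    using False by (auto simp: diff_quot_def mult.commute)
  ultimately show ?thesis by simp
qed

text \<open>Additivity holds off a null set that depends on the two directions; expanding v along
  the finite basis collects only finitely many of these sets.\<close>

lemma lipschitz_AE_dir_deriv_linear:
  fixes f :: "'a::euclidean_space \<Rightarrow> real"
  assumes f: "K-lipschitz_on UNIV f"
  shows "AE x in lborel. dir_deriv f v x = (\<Sum>b\<in>Basis. (v \<bullet> b) * dir_deriv f b x)"
proof -
  have "AE x in lborel. dir_deriv f (\<Sum>b\<in>S. (v \<bullet> b) *\<^sub>R b) x = (\<Sum>b\<in>S. (v \<bullet> b) * dir_deriv f b x)"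
    if "finite S" for S
    using that
  proof induction
    case empty
    have "diff_quot f 0 x = (\<lambda>h. 0)" for x by (auto simp: diff_quot_def)
    then have "dir_deriv f 0 x = 0" for x by (intro dir_deriv_eqI) simp
    then show ?case by simp
  next
    case (insert b S)
    from insert.IH lipschitz_AE_dir_deriv_add[OF f, of "(v \<bullet> b) *\<^sub>R b" "\<Sum>b\<in>S. (v \<bullet> b) *\<^sub>R b"]
      lipschitz_AE_tendsto_dir_deriv[OF f, of b]
    show ?case
    proof eventually_elim
      case (elim x)
      have "dir_deriv f ((v \<bullet> b) *\<^sub>R b) x = (v \<bullet> b) * dir_deriv f b x"
        by (intro dir_deriv_eqI tendsto_diff_quot_scale elim)
      with elim insert.hyps show ?case by simp
    qed
  qed
  from this[OF finite_Basis] show ?thesis by (simp add: euclidean_representation)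
qed

text \<open>By compactness, finitely many directions from D have \<delta>-balls covering the unit
  sphere, so their limits are uniform; the Lipschitz bound pays for replacing a unit direction by a
  nearby one of these.\<close>

lemma lipschitz_has_derivative_of_dense_directions:
  fixes f :: "'a::euclidean_space \<Rightarrow> real"
  assumes f: "K-lipschitz_on UNIV f"
    and dense: "\<And>x e. 0 < e \<Longrightarrow> \<exists>v\<in>D. dist x v < e"
    and lim: "\<And>v. v \<in> D \<Longrightarrow> (diff_quot f v x \<longlongrightarrow> v \<bullet> G) (at 0)"
  shows "(f has_derivative (\<lambda>h. h \<bullet> G)) (at x)"
  unfolding has_derivative_at_alt
proof (intro conjI allI impI)
  show "bounded_linear (\<lambda>h. h \<bullet> G)" by (rule bounded_linear_inner_left)
  fix e :: real assume e: "0 < e"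
  have K: "0 \<le> K" using f by (rule lipschitz_on_nonneg)
  define M where "M = K + norm G + 1"
  have M: "0 < M" using K by (simp add: M_def add_nonneg_pos)
  \<comment> \<open>The replacement costs at most \<delta> * (K + norm G) \<le> e / 2 per unit
    length; the other half of e is left for the quotients along the chosen directions.\<close>
  define \<delta> where "\<delta> = e / (2 * M)"
  have \<delta>: "0 < \<delta>" using e M by (simp add: \<delta>_def)
  have "sphere 0 1 \<subseteq> (\<Union>v\<in>D. ball v \<delta>)" using dense[OF \<delta>] by (fastforce simp: dist_commute)
  then obtain T where T: "T \<subseteq> D" "finite T" "sphere 0 1 \<subseteq> (\<Union>v\<in>T. ball v \<delta>)"
    using compactE_image[OF compact_sphere, of D "\<lambda>v. ball v \<delta>" 0 1] by auto
  have "\<forall>\<^sub>F h in at 0. \<forall>v\<in>T. dist (diff_quot f v x h) (v \<bullet> G) < e / 2"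
    using T e by (intro eventually_ball_finite ballI tendstoD lim) auto
  then obtain d where d: "0 < d"
    "\<And>h v. h \<noteq> 0 \<Longrightarrow> \<bar>h\<bar> < d \<Longrightarrow> v \<in> T \<Longrightarrow> \<bar>diff_quot f v x h - v \<bullet> G\<bar> < e / 2"
    unfolding eventually_at by (auto simp: dist_real_def)
  show "\<exists>d>0. \<forall>y. norm (y - x) < d \<longrightarrow> norm (f y - f x - (y - x) \<bullet> G) \<le> e * norm (y - x)"
  proof (intro exI[of _ d] conjI allI impI d)
    fix y assume y: "norm (y - x) < d"
    show "norm (f y - f x - (y - x) \<bullet> G) \<le> e * norm (y - x)"
    proof (cases "y = x")
      case False
      define h where "h = norm (y - x)"
      define u where "u = (y - x) /\<^sub>R h"
      have h: "0 < h" "h < d" using False y by (auto simp: h_def)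
      have yu: "y = x + h *\<^sub>R u" and "norm u = 1" using h by (auto simp: u_def h_def)
      then obtain v where v: "v \<in> T" "dist v u < \<delta>" using T(3) by fastforce
      have *: "dist v u = norm (v - u)" by (simp add: dist_norm)
      have "\<bar>f (x + h *\<^sub>R u) - f (x + h *\<^sub>R v)\<bar> \<le> K * dist (x + h *\<^sub>R u) (x + h *\<^sub>R v)"
        using lipschitz_onD[OF f, of "x + h *\<^sub>R u" "x + h *\<^sub>R v"] by (simp add: dist_real_def)
      also have "dist (x + h *\<^sub>R u) (x + h *\<^sub>R v) = h * dist v u"
        using h by (simp add: dist_norm norm_minus_commute flip: scaleR_diff_right)
      also have "K * (h * dist v u) \<le> K * (h * \<delta>)"
        using K h v by (intro mult_left_mono) auto
      finally have 1: "\<bar>f (x + h *\<^sub>R u) - f (x + h *\<^sub>R v)\<bar> \<le> h * (K * \<delta>)" by (simp add: ac_simps)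
      have "f (x + h *\<^sub>R v) - f x - h * (v \<bullet> G) = h * (diff_quot f v x h - v \<bullet> G)"
        unfolding diff_quot_def right_diff_distrib using h by simp
      moreover have "\<bar>h * (diff_quot f v x h - v \<bullet> G)\<bar> \<le> h * (e / 2)"
        using h d(2)[of h v] v by (simp add: abs_mult)
      ultimately have 2: "\<bar>f (x + h *\<^sub>R v) - f x - h * (v \<bullet> G)\<bar> \<le> h * (e / 2)" by simp
      have "\<bar>h * ((v - u) \<bullet> G)\<bar> \<le> h * (norm (v - u) * norm G)"
        using h Cauchy_Schwarz_ineq2[of "v - u" G] by (simp add: abs_mult)
      also have "\<dots> \<le> h * (\<delta> * norm G)"
        using h v * by (intro mult_left_mono mult_right_mono) auto
      finally have 3: "\<bar>h * (v \<bullet> G) - h * (u \<bullet> G)\<bar> \<le> h * (\<delta> * norm G)"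
        by (simp add: inner_diff_left right_diff_distrib)
      have "\<bar>f (x + h *\<^sub>R u) - f x - h * (u \<bullet> G)\<bar> \<le> h * (K * \<delta>) + h * (e / 2) + h * (\<delta> * norm G)"
        using 1 2 3 by linarith
      also have "\<dots> = h * (\<delta> * (K + norm G) + e / 2)" by (simp add: algebra_simps)
      also have "\<dots> \<le> h * (\<delta> * M + e / 2)"
        using h \<delta> by (intro mult_left_mono add_right_mono) (auto simp: M_def)
      also have "\<dots> = e * h" using M by (simp add: \<delta>_def)
      finally show ?thesis by (simp add: yu h_def[symmetric])
        (use h \<open>norm u = 1\<close> in simp)
    qed simp
  qed
qed

theorem Rademacher:
  fixes f :: "'a::euclidean_space \<Rightarrow> real"
  assumes f: "K-lipschitz_on UNIV f"
  shows "AE x in lborel. f differentiable (at x)"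
proof -
  obtain D :: "'a set" where D: "countable D" "\<And>X. open X \<Longrightarrow> X \<noteq> {} \<Longrightarrow> \<exists>d\<in>D. d \<in> X"
    by (rule countable_dense_exists[THEN exE]) blast
  \<comment> \<open>Countability of D merges the exceptional sets of all its directions into a
    single null set.\<close>
  have "AE x in lborel. \<forall>v\<in>D. (diff_quot f v x \<longlongrightarrow> dir_deriv f v x) (at 0) \<and>
      dir_deriv f v x = (\<Sum>b\<in>Basis. (v \<bullet> b) * dir_deriv f b x)"
    unfolding AE_ball_countable[OF D(1)]
    using lipschitz_AE_tendsto_dir_deriv[OF f] lipschitz_AE_dir_deriv_linear[OF f] by simp
  then show ?thesis
  proof eventually_elim
    case (elim x)
    define G where "G = (\<Sum>b\<in>Basis. dir_deriv f b x *\<^sub>R b)"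
    have "(diff_quot f v x \<longlongrightarrow> v \<bullet> G) (at 0)" if "v \<in> D" for v
      using elim that by (auto simp: G_def inner_sum_right mult.commute)
    moreover have "\<exists>v\<in>D. dist y v < e" if "0 < e" for y e
      using D(2)[of "ball y e"] that by auto
    ultimately have "(f has_derivative (\<lambda>h. h \<bullet> G)) (at x)"
      by (intro lipschitz_has_derivative_of_dense_directions[OF f]) auto
    then show ?case by (rule differentiableI)
  qed
qed

section \<open>Gradients of Lipschitz functions\<close>

lemma differentiable_GDERIV_grad:
  fixes f :: "'a::euclidean_space \<Rightarrow> real"
  assumes "f differentiable (at x)"
  shows "GDERIV f x :> grad f x"
proof -
  obtain f' where f': "(f has_derivative f') (at x)" using assms by (auto simp: differentiable_def)
  then have lin: "linear f'" by (intro bounded_linear.linear has_derivative_bounded_linear)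
  define G where "G = (\<Sum>b\<in>Basis. f' b *\<^sub>R b)"
  have "f' h = h \<bullet> G" for h
  proof -
    have "f' h = f' (\<Sum>b\<in>Basis. (h \<bullet> b) *\<^sub>R b)" by (simp add: euclidean_representation)
    also have "\<dots> = (\<Sum>b\<in>Basis. (h \<bullet> b) * f' b)"
      by (simp add: linear_sum[OF lin] linear_cmul[OF lin])
    also have "\<dots> = h \<bullet> G" by (simp add: G_def inner_sum_right mult.commute)
    finally show ?thesis .
  qed
  then have "f' = (\<lambda>h. h \<bullet> G)" by auto
  with f' have "GDERIV f x :> G" by (simp add: gderiv_def inner_commute)
  moreover have "D = G" if "GDERIV f x :> D" for D
  proof -
    have "(\<lambda>h. h \<bullet> D) = (\<lambda>h. h \<bullet> G)"
      using that \<open>GDERIV f x :> G\<close> unfolding gderiv_def by (rule has_derivative_unique)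
    then have "(D - G) \<bullet> D = (D - G) \<bullet> G" by metis
    then have "(D - G) \<bullet> (D - G) = 0" by (simp add: inner_diff_right)
    then show ?thesis by simp
  qed
  ultimately show ?thesis unfolding grad_def by (metis theI)
qed

text \<open>Differentiate along the gradient itself: the quotient in direction G tends to the square
  of norm G and is at most K * norm G.\<close>

lemma lipschitz_norm_grad_le:
  fixes f :: "'a::euclidean_space \<Rightarrow> real"
  assumes f: "K-lipschitz_on UNIV f" and "f differentiable (at x)"
  shows "norm (grad f x) \<le> K"
proof -
  define G where "G = grad f x"
  have "(f has_derivative (\<lambda>h. h \<bullet> G)) (at (x + 0 *\<^sub>R G))"
    using differentiable_GDERIV_grad[OF assms(2)] by (simp add: gderiv_def G_def)
  then have "((\<lambda>t. f (x + t *\<^sub>R G)) has_derivative (\<lambda>t. (t *\<^sub>R G) \<bullet> G)) (at 0)"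
    by (rule has_derivative_compose[rotated]) (auto intro!: derivative_eq_intros)
  then have "((\<lambda>t. f (x + t *\<^sub>R G)) has_field_derivative (G \<bullet> G)) (at 0)"
    by (simp add: has_field_derivative_def mult.commute[of _ "G \<bullet> G"])
  then have "(diff_quot f G x \<longlongrightarrow> G \<bullet> G) (at 0)"
    by (simp add: DERIV_def diff_quot_def[abs_def])
  then have "\<bar>G \<bullet> G\<bar> \<le> K * norm G" by (rule tendsto_dir_deriv_bound[OF f])
  then have "norm G * norm G \<le> K * norm G" by (simp add: dot_square_norm power2_eq_square)
  then show ?thesis
    using lipschitz_on_nonneg[OF f] unfolding G_def[symmetric] by (cases "G = 0") auto
qed

subsection \<open>Conditional value at risk\<close>

lemma prob_measuresD:
  assumes "M \<in> prob_measures"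
  shows "prob_space M" "sets M = sets borel" "space M = UNIV"
  using assms sets_eq_imp_space_eq[of M borel] by (auto simp: prob_measures_def)

context prob_space
begin

context
  fixes g :: "'a \<Rightarrow> real" and \<alpha> :: real
  assumes g: "integrable M g" and g0: "\<And>x. 0 \<le> g x" and \<alpha>: "0 < \<alpha>" "\<alpha> < 1"
begin

lemma integrable_excess: "integrable M (\<lambda>x. max 0 (g x - y))"
  using g by (intro integrable_max) auto

text \<open>Gives the real infimum in \<open>CVaR\<close> a lower bound. For y < 0 the expected
  excess is at least -y, and the factor 1 / (1 - \<alpha>) only enlarges it.\<close>

lemma CVaR_objective_nonneg: "0 \<le> CVaR_objective \<alpha> M g y"
proof (cases "0 \<le> y")
  case True
  then show ?thesis using \<alpha> by (simp add: CVaR_objective_def Bochner_Integration.integral_nonneg)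
next
  case False
  have "(\<integral>x. - y \<partial>M) \<le> (\<integral>x. max 0 (g x - y) \<partial>M)"
  proof (intro integral_mono integrable_excess)
    show "- y \<le> max 0 (g x - y)" for x using g0[of x] False by (auto simp: max_def)
  qed simp
  then have "- y \<le> (\<integral>x. max 0 (g x - y) \<partial>M)" by (simp add: prob_space)
  moreover have "(\<integral>x. max 0 (g x - y) \<partial>M) \<le> 1 / (1 - \<alpha>) * (\<integral>x. max 0 (g x - y) \<partial>M)"
    using \<alpha> mult_right_mono[of 1 "1 / (1 - \<alpha>)" "\<integral>x. max 0 (g x - y) \<partial>M"]
    by (simp add: Bochner_Integration.integral_nonneg)
  ultimately show ?thesis by (simp add: CVaR_objective_def)
qed

lemma CVaR_objective_ge: "y \<le> CVaR_objective \<alpha> M g y"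
  using \<alpha> by (simp add: CVaR_objective_def Bochner_Integration.integral_nonneg)

text \<open>The difference of the excesses over y and z equals z - y where g > z, vanishes where g
  \<le> y, and lies in between elsewhere; integration bounds it by the two tail
  probabilities.\<close>

lemma CVaR_objective_increment:
  assumes "y \<le> z"
  shows "(z - y) * (dist_fun M g y - \<alpha>) / (1 - \<alpha>)
        \<le> CVaR_objective \<alpha> M g z - CVaR_objective \<alpha> M g y" (is ?A)
    and "CVaR_objective \<alpha> M g z - CVaR_objective \<alpha> M g y
        \<le> (z - y) * (dist_fun M g z - \<alpha>) / (1 - \<alpha>)" (is ?B)
proof -
  have [measurable]: "g \<in> borel_measurable M" using g by auto
  let ?S = "\<lambda>c. {x \<in> space M. g x \<le> c}"
  have S: "(\<integral>x. (z - y) * (1 - indicator (?S c) x) \<partial>M) = (z - y) * (1 - dist_fun M g c)"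
    and intS: "integrable M (\<lambda>x. (z - y) * (1 - indicator (?S c) x))" for c
    by (auto simp: dist_fun_def prob_space emeasure_eq_measure)
  let ?I = "\<integral>x. max 0 (g x - y) - max 0 (g x - z) \<partial>M"
  have eq: "CVaR_objective \<alpha> M g z - CVaR_objective \<alpha> M g y = ((z - y) * (1 - \<alpha>) - ?I) / (1 - \<alpha>)"
    using \<alpha> by (simp add: CVaR_objective_def integrable_excess diff_divide_distrib)
  have "?I \<le> (\<integral>x. (z - y) * (1 - indicator (?S y) x) \<partial>M)"
    using assms by (intro integral_mono_AE intS Bochner_Integration.integrable_diff integrable_excess AE_I2)
      (auto simp: indicator_def max_def)
  then show ?A unfolding S eq using \<alpha> by (intro divide_right_mono) (auto simp: algebra_simps)
  have "(\<integral>x. (z - y) * (1 - indicator (?S z) x) \<partial>M) \<le> ?I"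
    using assms by (intro integral_mono_AE intS Bochner_Integration.integrable_diff integrable_excess AE_I2)
      (auto simp: indicator_def max_def)
  then show ?B unfolding S eq using \<alpha> by (intro divide_right_mono) (auto simp: algebra_simps)
qed

lemma dist_fun_mono: "c \<le> d \<Longrightarrow> dist_fun M g c \<le> dist_fun M g d"
  using g unfolding dist_fun_def by (intro finite_measure_mono) auto

lemma dist_fun_neg: "c < 0 \<Longrightarrow> dist_fun M g c = 0"
proof -
  assume "c < 0"
  then have "{x \<in> space M. g x \<le> c} = {}" using g0 by (auto simp: not_le intro: less_le_trans)
  then show ?thesis unfolding dist_fun_def by (simp only: measure_empty)
qed

text \<open>Otherwise the objective at any z \<ge> 0 would not exceed its value at 0, although it is
  at least z; the witness exceeds that value by one.\<close>

lemma ex_dist_fun_greater: "\<exists>c. \<alpha> < dist_fun M g c"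
proof (rule ccontr)
  assume "\<not> ?thesis"
  then have le: "dist_fun M g c \<le> \<alpha>" for c by (auto simp: not_less)
  define z where "z = CVaR_objective \<alpha> M g 0 + 1"
  have "0 \<le> z" using CVaR_objective_nonneg[of 0] by (simp add: z_def)
  then have "CVaR_objective \<alpha> M g z - CVaR_objective \<alpha> M g 0 \<le> z * (dist_fun M g z - \<alpha>) / (1 - \<alpha>)"
    using CVaR_objective_increment(2)[of 0 z] by simp
  also have "\<dots> \<le> 0" using \<alpha> le \<open>0 \<le> z\<close> by (intro divide_nonpos_pos mult_nonneg_nonpos) auto
  finally show False using CVaR_objective_ge[of z] by (simp add: z_def)
qed

text \<open>Quantifying over z > y instead of testing y itself avoids any appeal to right continuity
  of the distribution function, here and in the description of the minimizers.\<close>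

lemma VaR_le_iff: "VaR \<alpha> M g \<le> y \<longleftrightarrow> (\<forall>z>y. \<alpha> \<le> dist_fun M g z)"
proof -
  let ?S = "{c. \<alpha> \<le> dist_fun M g c}"
  have ne: "?S \<noteq> {}" using ex_dist_fun_greater by (auto intro: less_imp_le)
  have bdd: "bdd_below ?S"
    using dist_fun_neg \<alpha> by (intro bdd_belowI[of _ 0]) (force simp: not_le[symmetric])
  show ?thesis
  proof (intro iffI allI impI)
    fix z assume "VaR \<alpha> M g \<le> y" "y < z"
    then have "Inf ?S < z" by (simp add: VaR_def)
    then obtain c where "c \<in> ?S" "c < z" using cInf_lessD[OF ne] by blast
    then show "\<alpha> \<le> dist_fun M g z" using dist_fun_mono[of c z] by auto
  next
    assume "\<forall>z>y. \<alpha> \<le> dist_fun M g z"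
    then have "Inf ?S \<le> z" if "y < z" for z using that bdd by (intro cInf_lower) auto
    then show "VaR \<alpha> M g \<le> y" unfolding VaR_def by (rule dense_ge)
  qed
qed

lemma le_VaR_upper_iff: "y \<le> VaR_upper \<alpha> M g \<longleftrightarrow> (\<forall>c<y. dist_fun M g c \<le> \<alpha>)"
proof -
  let ?S = "{c. \<alpha> < dist_fun M g c}"
  have ne: "?S \<noteq> {}" using ex_dist_fun_greater by auto
  have bdd: "bdd_below ?S"
    using dist_fun_neg \<alpha> by (intro bdd_belowI[of _ 0]) (force simp: not_le[symmetric])
  show ?thesis
  proof (intro iffI allI impI)
    fix c assume "y \<le> VaR_upper \<alpha> M g" "c < y"
    then have "c < Inf ?S" by (simp add: VaR_upper_def)
    then show "dist_fun M g c \<le> \<alpha>" using cInf_lower[OF _ bdd, of c] by force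
  next
    assume "\<forall>c<y. dist_fun M g c \<le> \<alpha>"
    then show "y \<le> VaR_upper \<alpha> M g"
      unfolding VaR_upper_def by (intro cInf_greatest ne) (force simp: not_le[symmetric])
  qed
qed

lemma CVaR_minimizers_iff:
  "y \<in> CVaR_minimizers \<alpha> M g \<longleftrightarrow>
    (\<forall>z>y. \<alpha> \<le> dist_fun M g z) \<and> (\<forall>c<y. dist_fun M g c \<le> \<alpha>)"
proof -
  let ?F = "CVaR_objective \<alpha> M g" and ?\<Psi> = "dist_fun M g"
  have min: "y \<in> CVaR_minimizers \<alpha> M g \<longleftrightarrow> (\<forall>z. ?F y \<le> ?F z)"
    by (auto simp: CVaR_minimizers_def is_arg_min_def not_less)
  show ?thesis unfolding min
  proof (intro iffI conjI allI impI)
    fix z assume y: "\<forall>z. ?F y \<le> ?F z" and z: "y < z"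
    have "0 \<le> (z - y) * (?\<Psi> z - \<alpha>) / (1 - \<alpha>)"
      using CVaR_objective_increment(2)[of y z] y[rule_format, of z] z by linarith
    then show "\<alpha> \<le> ?\<Psi> z" using z \<alpha> by (simp add: zero_le_divide_iff zero_le_mult_iff)
  next
    fix c assume y: "\<forall>z. ?F y \<le> ?F z" and c: "c < y"
    have "(y - c) * (?\<Psi> c - \<alpha>) / (1 - \<alpha>) \<le> 0"
      using CVaR_objective_increment(1)[of c y] y[rule_format, of c] c by linarith
    then show "?\<Psi> c \<le> \<alpha>" using c \<alpha> by (simp add: divide_le_0_iff mult_le_0_iff)
  next
    assume *: "(\<forall>z>y. \<alpha> \<le> ?\<Psi> z) \<and> (\<forall>c<y. ?\<Psi> c \<le> \<alpha>)"
    fix z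
    consider "y < z" | "z < y" | "y = z" by linarith
    then show "?F y \<le> ?F z"
    proof cases
      case 1
      \<comment> \<open>The hypothesis speaks only of points beyond y, so z is first compared with w
        between y and z. Going from w back to y costs at most \<alpha> / (1 - \<alpha>) * (w - y)
        because \<Psi> \<ge> 0, and w tends to y.\<close>
      have "?F y - ?F z \<le> \<alpha> / (1 - \<alpha>) * (w - y)" if w: "y < w" "w < z" for w
      proof -
        have "0 \<le> (z - w) * (?\<Psi> w - \<alpha>) / (1 - \<alpha>)"
          using * w \<alpha> by (intro divide_nonneg_pos mult_nonneg_nonneg) auto
        also have "\<dots> \<le> ?F z - ?F w" using w by (intro CVaR_objective_increment) auto
        finally have "?F w \<le> ?F z" by simp
        moreover have "(w - y) * (0 - \<alpha>) / (1 - \<alpha>) \<le> (w - y) * (?\<Psi> y - \<alpha>) / (1 - \<alpha>)"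
          using w \<alpha> by (intro divide_right_mono mult_left_mono) (auto simp: dist_fun_def)
        moreover have "(w - y) * (0 - \<alpha>) / (1 - \<alpha>) = - (\<alpha> / (1 - \<alpha>) * (w - y))" by simp
        ultimately show ?thesis using CVaR_objective_increment(1)[of y w] w by linarith
      qed
      then have "\<forall>\<^sub>F w in at_right y. ?F y - ?F z \<le> \<alpha> / (1 - \<alpha>) * (w - y)"
        using 1 by (auto simp: eventually_at_right)
      moreover have "((\<lambda>w. \<alpha> / (1 - \<alpha>) * (w - y)) \<longlongrightarrow> \<alpha> / (1 - \<alpha>) * (y - y)) (at_right y)"
        by (intro tendsto_intros)
      ultimately have "?F y - ?F z \<le> \<alpha> / (1 - \<alpha>) * (y - y)"
        by (intro tendsto_lowerbound) auto
      then show ?thesis by simp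
    next
      case 2
      \<comment> \<open>If g has an atom at y, \<Psi> may exceed \<alpha> there, so the comparison
        is made at w < y. The slope from w to y is at most 1 because \<Psi> \<le> 1.\<close>
      have "?F y - ?F z \<le> y - w" if w: "z < w" "w < y" for w
      proof -
        have "?F w - ?F z \<le> (w - z) * (?\<Psi> w - \<alpha>) / (1 - \<alpha>)"
          using w by (intro CVaR_objective_increment) auto
        also have "\<dots> \<le> 0" using * w \<alpha> by (intro divide_nonpos_pos mult_nonneg_nonpos) auto
        finally have "?F w \<le> ?F z" by simp
        moreover have "?F y - ?F w \<le> (y - w) * (?\<Psi> y - \<alpha>) / (1 - \<alpha>)"
          using w by (intro CVaR_objective_increment) auto
        moreover have "(y - w) * (?\<Psi> y - \<alpha>) / (1 - \<alpha>) \<le> (y - w) * (1 - \<alpha>) / (1 - \<alpha>)"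
          using w \<alpha> by (intro divide_right_mono mult_left_mono) (auto simp: dist_fun_def)
        ultimately show ?thesis using \<alpha> by simp
      qed
      then have "\<forall>\<^sub>F w in at_left y. ?F y - ?F z \<le> y - w"
        using 2 by (auto simp: eventually_at_left)
      moreover have "((\<lambda>w. y - w) \<longlongrightarrow> y - y) (at_left y)" by (intro tendsto_intros)
      ultimately have "?F y - ?F z \<le> y - y" by (intro tendsto_lowerbound) auto
      then show ?thesis by simp
    qed simp
  qed
qed

lemma CVaR_minimizers_eq: "CVaR_minimizers \<alpha> M g = {VaR \<alpha> M g .. VaR_upper \<alpha> M g}"
  by (auto simp: CVaR_minimizers_iff VaR_le_iff le_VaR_upper_iff)

text \<open>A negative y fails the first condition at y / 2, where the distribution function is 0.
  Consequently g > y implies g \<noteq> 0, the region where g is assumed differentiable.\<close>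

lemma CVaR_minimizers_nonneg: "y \<in> CVaR_minimizers \<alpha> M g \<Longrightarrow> 0 \<le> y"
  using dist_fun_neg[of "y / 2"] \<alpha> unfolding CVaR_minimizers_iff
  by (cases "0 \<le> y") (auto simp: not_le dest!: spec[of _ "y / 2"])

end

end

section \<open>Stability under the Wasserstein distance\<close>

lemma ex_coupling_less:
  assumes "W1 Q \<gamma> < ennreal w"
  obtains \<pi> where "\<pi> \<in> couplings Q \<gamma>"
    "(\<integral>\<^sup>+ z. ennreal (dist (fst z) (snd z)) \<partial>\<pi>) < ennreal w"
  using assms unfolding W1_def by (auto simp: INF_less_iff)

text \<open>The elementary half of Kantorovich-Rubinstein duality. With a strict bound w, some
  coupling of cost below w is available without existence of an optimal one.\<close>

lemma lipschitz_integral_diff_le_W1: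
  fixes u :: "'a::{second_countable_topology, metric_space} \<Rightarrow> real"
  assumes u: "C-lipschitz_on UNIV u" and Q: "integrable Q u" and \<gamma>: "integrable \<gamma> u"
    and w: "W1 Q \<gamma> < ennreal w"
  shows "\<bar>(\<integral>x. u x \<partial>Q) - (\<integral>x. u x \<partial>\<gamma>)\<bar> \<le> C * w"
proof -
  obtain \<pi> where \<pi>: "\<pi> \<in> couplings Q \<gamma>"
    and less: "(\<integral>\<^sup>+ z. ennreal (dist (fst z) (snd z)) \<partial>\<pi>) < ennreal w"
    using ex_coupling_less[OF w] .
  have C: "0 \<le> C" using u by (rule lipschitz_on_nonneg)
  have w0: "0 \<le> w" using w by (metis ennreal_neg linorder_le_cases not_less_zero)
  have sets: "sets \<pi> = sets borel"
    and d: "distr \<pi> borel fst = Q" "distr \<pi> borel snd = \<gamma>"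
    using \<pi> by (auto simp: couplings_def prob_measures_def)
  have sets': "sets \<pi> = sets (borel \<Otimes>\<^sub>M borel)" unfolding borel_prod by (rule sets)
  have m: "fst \<in> measurable \<pi> borel" "snd \<in> measurable \<pi> borel"
    unfolding measurable_cong_sets[OF sets' refl] by auto
  have [measurable]: "u \<in> borel_measurable borel"
    by (intro borel_measurable_continuous_onI lipschitz_on_continuous_on[OF u])
  have i: "integrable \<pi> (\<lambda>z. u (fst z))" "integrable \<pi> (\<lambda>z. u (snd z))"
    using integrable_distr[OF m(1), of u] integrable_distr[OF m(2), of u] Q \<gamma> unfolding d by auto
  have e: "(\<integral>x. u x \<partial>Q) = (\<integral>z. u (fst z) \<partial>\<pi>)" "(\<integral>x. u x \<partial>\<gamma>) = (\<integral>z. u (snd z) \<partial>\<pi>)"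
    using integral_distr[OF m(1), of u] integral_distr[OF m(2), of u] unfolding d by auto
  have "ennreal (\<integral>z. \<bar>u (fst z) - u (snd z)\<bar> \<partial>\<pi>) = (\<integral>\<^sup>+z. ennreal \<bar>u (fst z) - u (snd z)\<bar> \<partial>\<pi>)"
    using i by (intro nn_integral_eq_integral[symmetric]) auto
  also have "\<dots> \<le> (\<integral>\<^sup>+z. ennreal C * ennreal (dist (fst z) (snd z)) \<partial>\<pi>)"
    using lipschitz_onD[OF u] C
    by (intro nn_integral_mono) (auto simp: dist_real_def intro!: ennreal_leI simp flip: ennreal_mult)
  also have "\<dots> = ennreal C * (\<integral>\<^sup>+z. ennreal (dist (fst z) (snd z)) \<partial>\<pi>)"
    by (intro nn_integral_cmult measurable_compose[OF _ measurable_ennreal] borel_measurable_dist m)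
  also have "\<dots> \<le> ennreal C * ennreal w" using less by (intro mult_left_mono) auto
  finally have "(\<integral>z. \<bar>u (fst z) - u (snd z)\<bar> \<partial>\<pi>) \<le> C * w"
    using C w0 by (simp flip: ennreal_mult)
  moreover have "\<bar>\<integral>z. u (fst z) - u (snd z) \<partial>\<pi>\<bar> \<le> (\<integral>z. \<bar>u (fst z) - u (snd z)\<bar> \<partial>\<pi>)"
    by (rule integral_abs_bound)
  ultimately show ?thesis unfolding e using i by simp
qed

lemma lipschitz_on_excess:
  fixes g :: "'a::metric_space \<Rightarrow> real"
  assumes "C-lipschitz_on UNIV g"
  shows "C-lipschitz_on UNIV (\<lambda>x. max 0 (g x - y))"
proof (rule lipschitz_onI)
  fix a b :: 'a
  show "dist (max 0 (g a - y)) (max 0 (g b - y)) \<le> C * dist a b"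
    using lipschitz_onD[OF assms UNIV_I UNIV_I, of a b] unfolding dist_real_def by linarith
qed (use lipschitz_on_nonneg[OF assms] in auto)

text \<open>Excesses inherit the Lipschitz constant of g, so the objectives of Q and P are close
  uniformly in y, and a uniform bound passes to the infima.\<close>

lemma CVaR_gap_le_W1:
  fixes g :: "'a::{second_countable_topology, metric_space} \<Rightarrow> real"
  assumes g: "C-lipschitz_on UNIV g" and g0: "\<And>x. 0 \<le> g x"
    and Q: "prob_space Q" "integrable Q g" and P: "prob_space P" "integrable P g"
    and \<alpha>: "0 < \<alpha>" "\<alpha> < 1" and w: "W1 Q P < ennreal w"
  shows "\<bar>CVaR_gap \<alpha> g Q P\<bar> \<le> C * w / (1 - \<alpha>)"
proof -
  interpret Q: prob_space Q by fact
  interpret P: prob_space P by fact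
  have obj: "\<bar>CVaR_objective \<alpha> Q g y - CVaR_objective \<alpha> P g y\<bar> \<le> C * w / (1 - \<alpha>)" for y
  proof -
    have "\<bar>(\<integral>x. max 0 (g x - y) \<partial>Q) - (\<integral>x. max 0 (g x - y) \<partial>P)\<bar> \<le> C * w"
      using Q.integrable_excess[OF Q(2) g0 \<alpha>] P.integrable_excess[OF P(2) g0 \<alpha>]
      by (intro lipschitz_integral_diff_le_W1[OF lipschitz_on_excess[OF g]] w)
    then have "\<bar>(\<integral>x. max 0 (g x - y) \<partial>Q) - (\<integral>x. max 0 (g x - y) \<partial>P)\<bar> / (1 - \<alpha>) \<le> C * w / (1 - \<alpha>)"
      using \<alpha> by (intro divide_right_mono) auto
    then show ?thesis
      using \<alpha> by (simp add: CVaR_objective_def flip: diff_divide_distrib)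
  qed
  have le: "CVaR \<alpha> R g \<le> CVaR \<alpha> S g + C * w / (1 - \<alpha>)"
    if nonneg: "\<And>y. 0 \<le> CVaR_objective \<alpha> R g y"
      and le: "\<And>y. CVaR_objective \<alpha> R g y \<le> CVaR_objective \<alpha> S g y + C * w / (1 - \<alpha>)" for R S
  proof -
    have "CVaR \<alpha> R g - C * w / (1 - \<alpha>) \<le> CVaR \<alpha> S g"
      unfolding CVaR_def[of _ S]
    proof (rule cINF_greatest)
      fix y
      have "CVaR \<alpha> R g \<le> CVaR_objective \<alpha> R g y"
        unfolding CVaR_def by (rule cINF_lower) (auto intro!: bdd_belowI[of _ 0] nonneg)
      with le[of y] show "CVaR \<alpha> R g - C * w / (1 - \<alpha>) \<le> CVaR_objective \<alpha> S g y" by simp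
    qed simp
    then show ?thesis by simp
  qed
  have "CVaR \<alpha> Q g \<le> CVaR \<alpha> P g + C * w / (1 - \<alpha>)"
    using obj[THEN abs_le_D1] by (intro le Q.CVaR_objective_nonneg[OF Q(2) g0 \<alpha>]) (simp add: algebra_simps)
  moreover have "CVaR \<alpha> P g \<le> CVaR \<alpha> Q g + C * w / (1 - \<alpha>)"
    using obj[THEN abs_le_D2] by (intro le P.CVaR_objective_nonneg[OF P(2) g0 \<alpha>]) (simp add: algebra_simps)
  ultimately show ?thesis by (simp add: CVaR_gap_def abs_le_iff)
qed

subsection \<open>The regularized divergence\<close>

text \<open>Integrate \<open>ln s \<le> s - 1\<close> at s = exp u / D over \<gamma>, where D is the
  density of \<gamma>. Compared with Donsker-Varadhan, the logarithm of the exponential moment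
  becomes the moment minus 1, which is nearly the same for small u.\<close>

lemma KL_variational_bound:
  fixes u :: "'a \<Rightarrow> real"
  assumes P: "prob_space P" and \<gamma>: "prob_space \<gamma>" "sets \<gamma> = sets P"
    and ac: "absolutely_continuous P \<gamma>"
    and ent: "integrable \<gamma> (entropy_density (exp 1) P \<gamma>)"
    and u: "integrable \<gamma> u" and eu: "integrable P (\<lambda>x. exp (u x))"
  shows "(\<integral>x. u x \<partial>\<gamma>) \<le> KL_divergence (exp 1) P \<gamma> + (\<integral>x. exp (u x) \<partial>P) - 1"
proof -
  interpret P: prob_space P by fact
  interpret \<gamma>: prob_space \<gamma> by fact
  obtain D where D: "D \<in> borel_measurable P" "AE x in P. RN_deriv P \<gamma> x = ennreal (D x)"
    "AE x in \<gamma>. 0 < D x" "\<And>x. 0 \<le> D x"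
    using P.real_RN_deriv[OF \<gamma>.finite_measure_axioms ac \<gamma>(2)] by blast
  note [measurable] = D(1)
  have [measurable]: "u \<in> borel_measurable P"
    using borel_measurable_integrable[OF u] by (simp add: measurable_cong_sets[OF \<gamma>(2) refl])
  have dens: "\<gamma> = density P (\<lambda>x. ennreal (D x))"
    using P.density_RN_deriv[OF ac \<gamma>(2)] D(2) by (subst (asm) density_cong[of _ _ "\<lambda>x. ennreal (D x)"]) auto
  have ent_eq: "AE x in \<gamma>. entropy_density (exp 1) P \<gamma> x = ln (D x)"
    using absolutely_continuous_AE[OF \<gamma>(2) ac D(2)]
    by eventually_elim (simp add: entropy_density_def D(4) log_def)
  let ?h = "\<lambda>x. exp (u x) / D x"
  \<comment> \<open>Where D vanishes the product is 0 rather than \<open>exp (u x)\<close>, since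
    division by 0 yields 0; this is why only an inequality is claimed.\<close>
  have bnd: "\<bar>D x * ?h x\<bar> \<le> exp (u x)" for x
    by (cases "D x = 0") auto
  have i1: "integrable P (\<lambda>x. D x * ?h x)"
    using bnd by (intro Bochner_Integration.integrable_bound[OF eu]) auto
  then have i2: "integrable \<gamma> ?h"
    unfolding dens by (subst integrable_real_density) (auto simp: D(4))
  have "(\<integral>x. u x - entropy_density (exp 1) P \<gamma> x \<partial>\<gamma>) \<le> (\<integral>x. ?h x - 1 \<partial>\<gamma>)"
  proof (intro integral_mono_AE Bochner_Integration.integrable_diff u ent i2)
    show "AE x in \<gamma>. u x - entropy_density (exp 1) P \<gamma> x \<le> ?h x - 1"
      using ent_eq D(3)
    proof eventually_elim
      case (elim x)
      have "u x - ln (D x) = ln (?h x)" using elim by (simp add: ln_div)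
      also have "\<dots> \<le> ?h x - 1" using elim by (intro ln_le_minus_one) auto
      finally show ?case using elim by simp
    qed
  qed auto
  then have "(\<integral>x. u x \<partial>\<gamma>) - KL_divergence (exp 1) P \<gamma> \<le> (\<integral>x. ?h x \<partial>\<gamma>) - 1"
    using u ent i2 by (simp add: KL_divergence_def \<gamma>.prob_space)
  also have "(\<integral>x. ?h x \<partial>\<gamma>) = (\<integral>x. D x * ?h x \<partial>P)"
    by (subst dens, subst integral_real_density) (auto simp: D(4))
  also have "\<dots> \<le> (\<integral>x. exp (u x) \<partial>P)"
    using bnd by (intro integral_mono i1 eu) (auto simp: abs_le_iff)
  finally show ?thesis by simp
qed

lemma exp_le_quadratic:
  fixes x :: real
  assumes "\<bar>x\<bar> \<le> 1"
  shows "exp x \<le> 1 + x + x\<^sup>2"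
proof (cases "0 \<le> x")
  case True
  then show ?thesis using assms by (intro exp_bound) auto
next
  case False
  define y where "y = - x"
  have y: "0 \<le> y" "y \<le> 1" using False assms by (auto simp: y_def)
  \<comment> \<open>For negative x the reciprocal is estimated: the quadratic Taylor polynomial of
    exp y times 1 - y + y * y is at least 1.\<close>
  have "exp x * (1 + y + y\<^sup>2 / 2) \<le> exp x * exp y"
    using y by (intro mult_left_mono exp_lower_Taylor_quadratic) auto
  also have "\<dots> = 1" by (simp add: y_def flip: exp_add)
  also have "1 \<le> 1 + (y\<^sup>2 + y ^ 3 + y ^ 4) / 2" using y by simp
  also have "\<dots> = (1 - y + y\<^sup>2) * (1 + y + y\<^sup>2 / 2)"
    by (simp add: field_simps power2_eq_square power3_eq_cube power4_eq_xxxx)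
  finally have "exp x \<le> 1 - y + y\<^sup>2"
    using y by (subst (asm) mult_le_cancel_right_pos) (auto intro: add_pos_nonneg)
  then show ?thesis by (simp add: y_def)
qed

text \<open>Test with t * f and divide by t. The parameter stays free: the divergence is weighted by
  1 / t, the second-order error of the exponential by t.\<close>

lemma bounded_integral_le_KL:
  fixes f :: "'a \<Rightarrow> real"
  assumes P: "prob_space P" and \<gamma>: "prob_space \<gamma>" "sets \<gamma> = sets P"
    and ac: "absolutely_continuous P \<gamma>"
    and ent: "integrable \<gamma> (entropy_density (exp 1) P \<gamma>)"
    and f[measurable]: "f \<in> borel_measurable P" and B: "\<And>x. \<bar>f x\<bar> \<le> B"
    and t: "0 < t" "t * B \<le> 1"
  shows "(\<integral>x. f x \<partial>\<gamma>) \<le> KL_divergence (exp 1) P \<gamma> / t + (\<integral>x. f x \<partial>P) + t * B\<^sup>2"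
proof -
  interpret P: prob_space P by fact
  interpret \<gamma>: prob_space \<gamma> by fact
  have [measurable]: "f \<in> borel_measurable \<gamma>" using f by (simp add: measurable_cong_sets[OF \<gamma>(2) refl])
  have iP: "integrable P f" by (rule P.integrable_const_bound[of _ B]) (use B in auto)
  have i\<gamma>: "integrable \<gamma> f" by (rule \<gamma>.integrable_const_bound[of _ B]) (use B in auto)
  have tf: "\<bar>t * f x\<bar> \<le> t * B" for x using B[of x] t by (simp add: abs_mult)
  have pt: "exp (t * f x) \<le> 1 + t * f x + (t * B)\<^sup>2" for x
  proof -
    have "(t * f x)\<^sup>2 \<le> (t * B)\<^sup>2" using tf[of x] by (metis abs_ge_zero power2_abs power_mono)
    with exp_le_quadratic[of "t * f x"] tf[of x] t show ?thesis by linarith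
  qed
  have ie: "integrable P (\<lambda>x. exp (t * f x))"
    by (rule P.integrable_const_bound[of _ "exp (t * B)"]) (use tf in \<open>auto simp: abs_le_iff\<close>)
  have "t * (\<integral>x. f x \<partial>\<gamma>) = (\<integral>x. t * f x \<partial>\<gamma>)" by simp
  also have "\<dots> \<le> KL_divergence (exp 1) P \<gamma> + (\<integral>x. exp (t * f x) \<partial>P) - 1"
    using i\<gamma> by (intro KL_variational_bound[OF P \<gamma> ac ent _ ie]) auto
  also have "(\<integral>x. exp (t * f x) \<partial>P) \<le> (\<integral>x. 1 + t * f x + (t * B)\<^sup>2 \<partial>P)"
    using iP pt by (intro integral_mono ie) auto
  also have "\<dots> = 1 + t * (\<integral>x. f x \<partial>P) + (t * B)\<^sup>2"
    using iP by (simp add: P.prob_space)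
  finally have "t * (\<integral>x. f x \<partial>\<gamma>) \<le> KL_divergence (exp 1) P \<gamma> + t * (\<integral>x. f x \<partial>P) + (t * B)\<^sup>2" by simp
  then show ?thesis using t by (simp add: field_simps power2_eq_square)
qed

text \<open>Gibbs' inequality, as the case f = 0 of the preceding bound.\<close>

lemma KL_nonneg_of_integrable:
  assumes "prob_space P" "prob_space \<gamma>" "sets \<gamma> = sets P" "absolutely_continuous P \<gamma>"
    and "integrable \<gamma> (entropy_density (exp 1) P \<gamma>)"
  shows "0 \<le> KL_divergence (exp 1) P \<gamma>"
  using bounded_integral_le_KL[OF assms, of "\<lambda>_. 0" 0 1] by simp

lemma D_KL_nonneg:
  assumes "prob_space P" "prob_space \<gamma>" "sets \<gamma> = sets P"
  shows "0 \<le> D_KL \<gamma> P"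
  using KL_nonneg_of_integrable[OF assms] by (simp add: D_KL_def)

lemma D_KL_self:
  assumes "prob_space P"
  shows "D_KL P P = 0"
proof -
  interpret prob_space P by fact
  have "AE x in P. 1 = RN_deriv P P x"
    by (rule RN_deriv_unique) (auto simp: density_1)
  then have "AE x in P. entropy_density (exp 1) P P x = 0"
    by eventually_elim (metis entropy_density_def comp_apply enn2real_1 log_one)
  then have "integrable P (entropy_density (exp 1) P P)"
    by (subst integrable_cong_AE[of _ _ "\<lambda>_. 0"]) auto
  then show ?thesis
    by (simp add: D_KL_def KL_same_eq_0 absolutely_continuous_def zero_ereal_def)
qed

section \<open>Bounds for the regularized divergence\<close>

lemma lip_KL_nonneg:
  assumes "P \<in> prob_measures" "0 \<le> L"
  shows "0 \<le> lip_KL L Q P"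
  unfolding lip_KL_def
proof (rule INF_greatest)
  fix \<gamma> :: "'a measure" assume "\<gamma> \<in> prob_measures"
  then have "0 \<le> D_KL \<gamma> P"
    using assms by (intro D_KL_nonneg) (auto simp: prob_measures_def)
  then show "0 \<le> D_KL \<gamma> P + ereal L * enn2ereal (W1 Q \<gamma>)"
    using assms by (intro add_nonneg_nonneg) (auto intro: ereal_0_le_mult)
qed

lemma lip_KL_le_W1:
  assumes "P \<in> prob_measures"
  shows "lip_KL L Q P \<le> ereal L * enn2ereal (W1 Q P)"
proof -
  have "lip_KL L Q P \<le> D_KL P P + ereal L * enn2ereal (W1 Q P)"
    unfolding lip_KL_def by (rule INF_lower[OF assms])
  then show ?thesis using assms by (simp add: D_KL_self prob_measures_def)
qed

text \<open>Both summands are nonnegative, so a competitor whose total stays below \<delta> is at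
  once close to P in divergence and to Q in transport cost.\<close>

lemma lip_KL_less_obtain:
  assumes P: "P \<in> prob_measures" and L: "0 < L" and less: "lip_KL L Q P < ereal \<delta>"
  obtains \<gamma> where "\<gamma> \<in> prob_measures" "absolutely_continuous P \<gamma>"
    "integrable \<gamma> (entropy_density (exp 1) P \<gamma>)" "0 \<le> KL_divergence (exp 1) P \<gamma>"
    "KL_divergence (exp 1) P \<gamma> < \<delta>" "W1 Q \<gamma> < ennreal (\<delta> / L)"
proof -
  obtain \<gamma> where \<gamma>: "\<gamma> \<in> prob_measures" "D_KL \<gamma> P + ereal L * enn2ereal (W1 Q \<gamma>) < ereal \<delta>"
    using less unfolding lip_KL_def by (auto simp: INF_less_iff)
  have *: "absolutely_continuous P \<gamma>" "integrable \<gamma> (entropy_density (exp 1) P \<gamma>)"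
    using \<gamma>(2) by (auto simp: D_KL_def split: if_splits)
  have KL: "0 \<le> KL_divergence (exp 1) P \<gamma>"
    using P \<gamma>(1) * by (intro KL_nonneg_of_integrable) (auto simp: prob_measures_def)
  have lt: "ereal (KL_divergence (exp 1) P \<gamma>) + ereal L * enn2ereal (W1 Q \<gamma>) < ereal \<delta>"
    using \<gamma>(2) * by (simp add: D_KL_def)
  show thesis
  proof (cases "W1 Q \<gamma>")
    case (real w)
    then have sum: "KL_divergence (exp 1) P \<gamma> + L * w < \<delta>" using lt by simp
    moreover have "0 \<le> L * w" using L real by simp
    ultimately have "KL_divergence (exp 1) P \<gamma> < \<delta>" "w < \<delta> / L"
      using KL L by (auto simp: field_simps)
    then show thesis using real \<gamma>(1) * KL by (intro that[of \<gamma>]) (auto simp: ennreal_lessI)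
  \<comment> \<open>An infinite transport cost is excluded because L > 0; for L = 0 the product
    would be 0.\<close>
  qed (use lt L in simp)
qed

text \<open>The product measure is a coupling, and by the triangle inequality its cost is at most
  the sum of the first moments.\<close>

lemma W1_finite:
  fixes Q \<gamma> :: "'a::{second_countable_topology, real_normed_vector} measure"
  assumes Q: "Q \<in> prob_measures" "finite_first_moment Q"
    and \<gamma>: "\<gamma> \<in> prob_measures" "finite_first_moment \<gamma>"
  shows "W1 Q \<gamma> < \<infinity>"
proof -
  note D = prob_measuresD[OF Q(1)] prob_measuresD[OF \<gamma>(1)]
  interpret Q: prob_space Q by fact
  interpret \<gamma>: prob_space \<gamma> by fact
  interpret pair_prob_space Q \<gamma> ..
  let ?\<pi> = "Q \<Otimes>\<^sub>M \<gamma>"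
  have sets: "sets ?\<pi> = sets borel"
    unfolding borel_prod[symmetric] using D by (intro sets_pair_measure_cong) auto
  have m: "fst \<in> measurable ?\<pi> Q" "snd \<in> measurable ?\<pi> \<gamma>" by auto
  have mb: "fst \<in> borel_measurable ?\<pi>" "snd \<in> borel_measurable ?\<pi>"
    using m by (simp_all add: measurable_cong_sets[OF refl D(2)] measurable_cong_sets[OF refl D(5)])
  have 1: "distr ?\<pi> borel fst = Q"
  proof -
    have "distr ?\<pi> borel fst = distr ?\<pi> Q fst" using D by (intro distr_cong) auto
    then show ?thesis using \<gamma>.distr_pair_fst by simp
  qed
  have 2: "distr ?\<pi> borel snd = \<gamma>"
  proof (rule measure_eqI)
    fix A assume "A \<in> sets (distr ?\<pi> borel snd)"
    then have A: "A \<in> sets borel" "A \<in> sets \<gamma>" using D by auto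
    have "snd -` A \<inter> space ?\<pi> = space Q \<times> A"
      using sets.sets_into_space[OF A(2)] by (auto simp: space_pair_measure)
    then show "emeasure (distr ?\<pi> borel snd) A = emeasure \<gamma> A"
      using A mb by (simp add: emeasure_distr \<gamma>.emeasure_pair_measure_Times Q.emeasure_space_1)
  qed (use D in simp)
  have "?\<pi> \<in> couplings Q \<gamma>"
    using 1 2 sets prob_space_axioms by (simp add: couplings_def prob_measures_def)
  then have "W1 Q \<gamma> \<le> (\<integral>\<^sup>+ z. ennreal (dist (fst z) (snd z)) \<partial>?\<pi>)"
    unfolding W1_def by (rule INF_lower)
  also have "\<dots> \<le> (\<integral>\<^sup>+ z. ennreal (norm (fst z)) + ennreal (norm (snd z)) \<partial>?\<pi>)"
    by (intro nn_integral_mono) (auto simp: dist_norm norm_triangle_ineq4 simp flip: ennreal_plus intro!: ennreal_leI)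
  also have "\<dots> = (\<integral>\<^sup>+ z. ennreal (norm (fst z)) \<partial>?\<pi>) + (\<integral>\<^sup>+ z. ennreal (norm (snd z)) \<partial>?\<pi>)"
    using mb by (intro nn_integral_add) auto
  also have "(\<integral>\<^sup>+ z. ennreal (norm (fst z)) \<partial>?\<pi>) = (\<integral>\<^sup>+ x. ennreal (norm x) \<partial>Q)"
    by (subst (2) 1[symmetric], subst nn_integral_distr) (use mb in auto)
  also have "(\<integral>\<^sup>+ z. ennreal (norm (snd z)) \<partial>?\<pi>) = (\<integral>\<^sup>+ x. ennreal (norm x) \<partial>\<gamma>)"
    by (subst (2) 2[symmetric], subst nn_integral_distr) (use mb in auto)
  also have "(\<integral>\<^sup>+ x. ennreal (norm x) \<partial>Q) + (\<integral>\<^sup>+ x. ennreal (norm x) \<partial>\<gamma>) < \<infinity>"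
    using Q(2) \<gamma>(2) by (simp add: finite_first_moment_def integrable_iff_bounded)
  finally show ?thesis .
qed

text \<open>
  \<open>P\<close> itself may have an infinite first moment; conditioning it on a ball of positive mass gives
  a measure with finite first moment and finite divergence from \<open>P\<close>.
\<close>

lemma lip_KL_finite:
  fixes Q P :: "'a::{second_countable_topology, real_normed_vector} measure"
  assumes Q: "Q \<in> prob_measures" "finite_first_moment Q" and P: "P \<in> prob_measures"
  shows "lip_KL L Q P < \<infinity>"
proof -
  note D = prob_measuresD[OF P]
  interpret P: prob_space P by fact
  have "(\<Union>n. cball 0 (real n)) = (UNIV :: 'a set)" using real_arch_simple by auto
  moreover have "(\<lambda>n. measure P (cball 0 (real n))) \<longlonglongrightarrow> measure P (\<Union>n. cball 0 (real n))"
    by (intro P.finite_Lim_measure_incseq) (auto simp: D incseq_def)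
  ultimately have "(\<lambda>n. measure P (cball 0 (real n))) \<longlonglongrightarrow> 1" using P.prob_space D by simp
  then have "\<forall>\<^sub>F n in sequentially. 0 < measure P (cball 0 (real n))"
    by (rule order_tendstoD) simp
  then obtain n where n: "0 < measure P (cball 0 (real n))" by (auto simp: eventually_sequentially)
  define B where "B = (cball 0 (real n) :: 'a set)"
  define p where "p = measure P B"
  have p: "0 < p" using n by (simp add: p_def B_def)
  have B[measurable]: "B \<in> sets P" by (simp add: B_def D)
  define w where "w x = indicator B x / p" for x :: 'a
  have w0: "0 \<le> w x" for x using p by (simp add: w_def)
  have [measurable]: "w \<in> borel_measurable P" unfolding w_def by measurable
  define \<gamma> where "\<gamma> = density P (\<lambda>x. ennreal (w x))"
  have sets_\<gamma>[measurable_cong]: "sets \<gamma> = sets P" by (simp add: \<gamma>_def)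
  have "(\<integral>\<^sup>+x. ennreal (w x) \<partial>P) = ennreal (\<integral>x. w x \<partial>P)"
    using w0 by (intro nn_integral_eq_integral) (auto simp: w_def[abs_def] P.emeasure_eq_measure)
  also have "(\<integral>x. w x \<partial>P) = 1" using p by (simp add: w_def[abs_def] p_def)
  finally have "prob_space \<gamma>"
    by (intro prob_spaceI) (simp add: \<gamma>_def emeasure_density)
  then interpret \<gamma>: prob_space \<gamma> .
  have \<gamma>: "\<gamma> \<in> prob_measures"
    using \<open>prob_space \<gamma>\<close> sets_\<gamma> D by (simp add: prob_measures_def)
  have AE_B: "AE x in \<gamma>. x \<in> B"
    unfolding \<gamma>_def by (subst AE_density) (auto simp: w_def indicator_def)
  have ffm: "finite_first_moment \<gamma>" unfolding finite_first_moment_def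
    by (rule \<gamma>.integrable_const_bound[of _ "real n"])
       (use AE_B D in \<open>auto simp: B_def sets_\<gamma> measurable_cong_sets[OF sets_\<gamma> refl]
          measurable_cong_sets[OF D(2) refl]\<close>)
  have ac: "absolutely_continuous P \<gamma>"
    unfolding \<gamma>_def by (rule absolutely_continuousI_density) simp
  have "AE x in P. ennreal (w x) = RN_deriv P \<gamma> x"
    by (rule P.RN_deriv_unique) (auto simp: \<gamma>_def)
  then have "AE x in \<gamma>. ennreal (w x) = RN_deriv P \<gamma> x"
    by (rule absolutely_continuous_AE[OF sets_\<gamma> ac])
  \<comment> \<open>The density is constant on B, so the entropy density is almost everywhere
    constant and hence integrable.\<close>
  then have "AE x in \<gamma>. entropy_density (exp 1) P \<gamma> x = ln (1 / p)"
    using AE_B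
  proof eventually_elim
    case (elim x)
    then show ?case using w0[of x] by (simp add: entropy_density_def log_def flip: elim(1)) (simp add: w_def)
  qed
  then have "integrable \<gamma> (entropy_density (exp 1) P \<gamma>)"
    by (subst integrable_cong_AE[of _ _ "\<lambda>_. ln (1 / p)"])
       (auto simp: measurable_cong_sets[OF sets_\<gamma> refl])
  with ac have "D_KL \<gamma> P < \<infinity>" by (simp add: D_KL_def)
  moreover have "ereal L * enn2ereal (W1 Q \<gamma>) < \<infinity>"
    using W1_finite[OF Q \<gamma> ffm] by (cases "W1 Q \<gamma>") auto
  ultimately have "D_KL \<gamma> P + ereal L * enn2ereal (W1 Q \<gamma>) < \<infinity>" by auto
  then show ?thesis unfolding lip_KL_def
    using INF_lower[OF \<gamma>, of "\<lambda>\<gamma>. D_KL \<gamma> P + ereal L * enn2ereal (W1 Q \<gamma>)"] by (rule le_less_trans[rotated])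
qed

section \<open>Lipschitz minorants by infimal convolution (Pasch-Hausdorff envelopes)\<close>

definition lip_lower :: "('a::metric_space \<Rightarrow> real) \<Rightarrow> nat \<Rightarrow> 'a \<Rightarrow> real" where
  "lip_lower f k x = (INF y. f y + real k * dist x y)"

context
  fixes f :: "'a::metric_space \<Rightarrow> real" and B :: real
  assumes B: "\<And>x. \<bar>f x\<bar> \<le> B"
begin

lemma lip_lower_summand_ge: "- B \<le> f y + real k * dist x y"
  using B[of y] by (smt (verit) mult_nonneg_nonneg of_nat_0_le_iff zero_le_dist)

lemma bdd_below_lip_lower: "bdd_below (range (\<lambda>y. f y + real k * dist x y))"
  using lip_lower_summand_ge by (auto intro!: bdd_belowI[of _ "- B"])

lemma lip_lower_le_summand: "lip_lower f k x \<le> f y + real k * dist x y"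
  unfolding lip_lower_def by (rule cINF_lower[OF bdd_below_lip_lower]) simp

lemma lip_lower_le: "lip_lower f k x \<le> f x"
  using lip_lower_le_summand[of k x x] by simp

lemma lip_lower_bound: "\<bar>lip_lower f k x\<bar> \<le> B"
proof -
  have "- B \<le> lip_lower f k x"
    unfolding lip_lower_def by (rule cINF_greatest) (simp_all add: lip_lower_summand_ge)
  then show ?thesis using lip_lower_le[of k x] B[of x] by linarith
qed

lemma lipschitz_lip_lower: "(real k)-lipschitz_on UNIV (lip_lower f k)"
proof (rule lipschitz_onI)
  have *: "lip_lower f k a - real k * dist a b \<le> lip_lower f k b" for a b
    unfolding lip_lower_def[of f k b]
  proof (rule cINF_greatest)
    fix y
    have "real k * dist a y \<le> real k * (dist a b + dist b y)"
      by (intro mult_left_mono dist_triangle) simp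
    then show "lip_lower f k a - real k * dist a b \<le> f y + real k * dist b y"
      using lip_lower_le_summand[of k a y] by (simp add: distrib_left)
  qed simp
  show "dist (lip_lower f k a) (lip_lower f k b) \<le> real k * dist a b" for a b
    using *[of a b] *[of b a] unfolding dist_real_def by (simp add: dist_commute abs_le_iff)
qed simp

lemma lip_lower_tendsto:
  assumes f: "continuous_on UNIV f"
  shows "(\<lambda>k. lip_lower f k x) \<longlonglongrightarrow> f x"
proof (rule LIMSEQ_I)
  fix e :: real assume e: "0 < e"
  then obtain d where d: "0 < d" "\<And>y. dist y x < d \<Longrightarrow> dist (f y) (f x) < e / 2"
    using f[unfolded continuous_on_iff, rule_format, of x "e / 2"] by auto
  \<comment> \<open>Beyond distance d the penalty reaches 2 * B, the largest possible drop of f, so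
    only points within d can push the infimum below f x.\<close>
  obtain k0 :: nat where k0: "2 * B / d < k0" using reals_Archimedean2 by blast
  have "norm (lip_lower f k x - f x) < e" if k: "k0 \<le> k" for k
  proof -
    have "f x - e / 2 \<le> lip_lower f k x"
      unfolding lip_lower_def
    proof (rule cINF_greatest)
      fix y
      show "f x - e / 2 \<le> f y + real k * dist x y"
      proof (cases "dist y x < d")
        case True
        have "f x - e / 2 \<le> f y" using d(2)[OF True] unfolding dist_real_def by linarith
        then show ?thesis by (simp add: add_increasing2)
      next
        case False
        have "2 * B / d * d \<le> real k * dist x y"
          using False k k0 d(1) by (intro mult_mono) (auto simp: dist_commute)
        then have "2 * B \<le> real k * dist x y" using d(1) by simp
        then show ?thesis using B[of x] B[of y] e by linarith
      qed
    qed simp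
    then show ?thesis using lip_lower_le[of k x] e by simp
  qed
  then show "\<exists>no. \<forall>k\<ge>no. norm (lip_lower f k x - f x) < e" by blast
qed

end

section \<open>Vanishing regularized divergence and weak convergence\<close>

lemma lip_KL_tendsto_0_lipschitz_upper:
  fixes f :: "'a::{second_countable_topology, metric_space} \<Rightarrow> real"
  assumes P: "P \<in> prob_measures" and Qs: "\<And>n. Qs n \<in> prob_measures" and L: "0 < L"
    and lim: "(\<lambda>n. lip_KL L (Qs n) P) \<longlonglongrightarrow> 0"
    and f: "C-lipschitz_on UNIV f" and B: "\<And>x. \<bar>f x\<bar> \<le> B" and e: "0 < e"
  shows "\<forall>\<^sub>F n in sequentially. (\<integral>x. f x \<partial>Qs n) \<le> (\<integral>x. f x \<partial>P) + e"
proof -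
  have C: "0 \<le> C" using f by (rule lipschitz_on_nonneg)
  have B0: "0 \<le> B" using B[of undefined] by linarith
  \<comment> \<open>Small enough for the exponential estimate (t * B \<le> 1) and for its
    second-order error to stay below e / 3.\<close>
  define t where "t = min (e / (3 * (B\<^sup>2 + 1))) (1 / (B + 1))"
  have t: "0 < t" using e B0 by (auto simp: t_def intro!: divide_pos_pos add_nonneg_pos)
  have "t * B \<le> 1 / (B + 1) * B" using B0 by (intro mult_right_mono) (auto simp: t_def)
  also have "\<dots> \<le> 1" using B0 by simp
  finally have tB: "t * B \<le> 1" .
  have "t * B\<^sup>2 \<le> e / (3 * (B\<^sup>2 + 1)) * B\<^sup>2" by (intro mult_right_mono) (auto simp: t_def)
  also have "\<dots> = e / 3 * (B\<^sup>2 / (B\<^sup>2 + 1))" by simp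
  also have "\<dots> \<le> e / 3 * 1"
    using e by (intro mult_left_mono) (auto simp: divide_le_eq add_nonneg_pos)
  finally have tB2: "t * B\<^sup>2 \<le> e / 3" by simp
  \<comment> \<open>Chosen after t: the divergence over t and the transport error C * \<delta> / L
    each take at most another third of e.\<close>
  define \<delta> where "\<delta> = min (t * e / 3) (L * e / (3 * (C + 1)))"
  have \<delta>: "0 < \<delta>" using t e L C by (auto simp: \<delta>_def intro!: divide_pos_pos mult_pos_pos add_nonneg_pos)
  have "\<delta> / t \<le> (t * e / 3) / t" using t unfolding \<delta>_def by (intro divide_right_mono min.cobounded1) simp
  then have \<delta>t: "\<delta> / t \<le> e / 3" using t by simp
  have "C * (\<delta> / L) \<le> C * ((L * e / (3 * (C + 1))) / L)"
    using C L by (intro mult_left_mono divide_right_mono) (auto simp: \<delta>_def)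
  also have "\<dots> = e / 3 * (C / (C + 1))" using L by simp
  also have "\<dots> \<le> e / 3 * 1" using e C by (intro mult_left_mono) auto
  finally have C\<delta>: "C * (\<delta> / L) \<le> e / 3" by simp
  have [measurable]: "f \<in> borel_measurable borel"
    by (intro borel_measurable_continuous_onI lipschitz_on_continuous_on[OF f])
  have int: "integrable M f" if "M \<in> prob_measures" for M
  proof -
    note D = prob_measuresD[OF that]
    interpret prob_space M by fact
    show ?thesis
      by (rule integrable_const_bound[of _ B]) (use B D in \<open>auto simp: measurable_cong_sets[OF D(2) refl]\<close>)
  qed
  have "\<forall>\<^sub>F n in sequentially. lip_KL L (Qs n) P < ereal \<delta>"
    by (rule order_tendstoD(2)[OF lim]) (use \<delta> in simp)
  then show ?thesis
  proof eventually_elim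
    case (elim n)
    obtain \<gamma> where \<gamma>: "\<gamma> \<in> prob_measures" "absolutely_continuous P \<gamma>"
      "integrable \<gamma> (entropy_density (exp 1) P \<gamma>)"
      "KL_divergence (exp 1) P \<gamma> < \<delta>" "W1 (Qs n) \<gamma> < ennreal (\<delta> / L)"
      by (rule lip_KL_less_obtain[OF P L elim])
    note D = prob_measuresD[OF P] prob_measuresD[OF \<gamma>(1)]
    have "(\<integral>x. f x \<partial>\<gamma>) \<le> KL_divergence (exp 1) P \<gamma> / t + (\<integral>x. f x \<partial>P) + t * B\<^sup>2"
      using D \<gamma> B t tB by (intro bounded_integral_le_KL) (auto simp: measurable_cong_sets[OF D(2) refl])
    moreover have "KL_divergence (exp 1) P \<gamma> / t \<le> \<delta> / t"
      using \<gamma>(4) t by (intro divide_right_mono) auto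
    moreover have "\<bar>(\<integral>x. f x \<partial>Qs n) - (\<integral>x. f x \<partial>\<gamma>)\<bar> \<le> C * (\<delta> / L)"
      by (intro lipschitz_integral_diff_le_W1[OF f] int Qs \<gamma>)
    ultimately show ?case using tB2 \<delta>t C\<delta> by linarith
  qed
qed

text \<open>A minorant is needed to be close to f only under P, which dominated convergence
  provides; under every \<open>Qs n\<close> it simply lies below f. Hence k is fixed independently
  of n and no tightness argument arises.\<close>

lemma lip_KL_tendsto_0_continuous_lower:
  fixes f :: "'a::{second_countable_topology, metric_space} \<Rightarrow> real"
  assumes P: "P \<in> prob_measures" and Qs: "\<And>n. Qs n \<in> prob_measures" and L: "0 < L"
    and lim: "(\<lambda>n. lip_KL L (Qs n) P) \<longlonglongrightarrow> 0"
    and f: "continuous_on UNIV f" and B: "\<And>x. \<bar>f x\<bar> \<le> B" and e: "0 < e"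
  shows "\<forall>\<^sub>F n in sequentially. (\<integral>x. f x \<partial>P) - e \<le> (\<integral>x. f x \<partial>Qs n)"
proof -
  have int: "integrable M u" if "M \<in> prob_measures" "continuous_on UNIV u" "\<And>x. \<bar>u x\<bar> \<le> B"
    for M and u :: "'a \<Rightarrow> real"
  proof -
    note D = prob_measuresD[OF that(1)]
    interpret prob_space M by fact
    show ?thesis
      by (rule integrable_const_bound[of _ B])
         (use that(3) D borel_measurable_continuous_onI[OF that(2)]
           in \<open>auto simp: measurable_cong_sets[OF D(2) refl]\<close>)
  qed
  note lip = lipschitz_lip_lower[of f, OF B] and bnd = lip_lower_bound[of f, OF B]
  note cont = lipschitz_on_continuous_on[OF lip]
  have "(\<lambda>k. \<integral>x. lip_lower f k x \<partial>P) \<longlonglongrightarrow> (\<integral>x. f x \<partial>P)"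
  proof (rule integral_dominated_convergence)
    interpret P: prob_space P using P by (rule prob_measuresD)
    show "integrable P (\<lambda>_. B)" by simp
    show "f \<in> borel_measurable P" "lip_lower f k \<in> borel_measurable P" for k
      using int[OF P f B] int[OF P cont bnd] by auto
    show "AE x in P. (\<lambda>k. lip_lower f k x) \<longlonglongrightarrow> f x"
      using lip_lower_tendsto[OF B f] by simp
    show "AE x in P. norm (lip_lower f k x) \<le> B" for k using bnd by simp
  qed
  then have "\<forall>\<^sub>F k in sequentially. (\<integral>x. f x \<partial>P) - e / 2 < (\<integral>x. lip_lower f k x \<partial>P)"
    by (rule order_tendstoD) (use e in simp)
  then obtain k where k: "(\<integral>x. f x \<partial>P) - e / 2 < (\<integral>x. lip_lower f k x \<partial>P)"
    by (auto simp: eventually_sequentially)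
  have "(real k)-lipschitz_on UNIV (\<lambda>x. - lip_lower f k x)"
    using lip by (simp add: lipschitz_on_minus_iff)
  then have "\<forall>\<^sub>F n in sequentially.
      (\<integral>x. - lip_lower f k x \<partial>Qs n) \<le> (\<integral>x. - lip_lower f k x \<partial>P) + e / 2"
    using bnd e by (intro lip_KL_tendsto_0_lipschitz_upper[OF P Qs L lim]) auto
  then show ?thesis
  proof eventually_elim
    case (elim n)
    have "(\<integral>x. lip_lower f k x \<partial>Qs n) \<le> (\<integral>x. f x \<partial>Qs n)"
      by (intro integral_mono int[OF Qs cont bnd] int[OF Qs f B] lip_lower_le[OF B])
    with elim k show ?case by simp
  qed
qed

text \<open>The one-sided estimate for f and for -f gives both halves of the limit.\<close>

lemma lip_KL_tendsto_0_converges_weakly: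
  fixes P :: "'a::{second_countable_topology, metric_space} measure"
  assumes P: "P \<in> prob_measures" and Qs: "\<And>n. Qs n \<in> prob_measures" and L: "0 < L"
    and lim: "(\<lambda>n. lip_KL L (Qs n) P) \<longlonglongrightarrow> 0"
  shows "converges_weakly Qs P"
  unfolding converges_weakly_def
proof (intro allI impI, elim conjE)
  fix f :: "'a \<Rightarrow> real" assume f: "continuous_on UNIV f" and "bounded (range f)"
  then obtain B where B: "\<And>x. \<bar>f x\<bar> \<le> B" by (auto simp: bounded_iff)
  note lower = lip_KL_tendsto_0_continuous_lower[OF P Qs L lim]
  show "(\<lambda>n. \<integral>x. f x \<partial>Qs n) \<longlonglongrightarrow> (\<integral>x. f x \<partial>P)"
  proof (rule tendstoI)
    fix e :: real assume "0 < e"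
    then have e: "0 < e / 2" by simp
    have "\<forall>\<^sub>F n in sequentially. (\<integral>x. - f x \<partial>P) - e / 2 \<le> (\<integral>x. - f x \<partial>Qs n)"
      using B by (intro lower[OF _ _ e] continuous_intros f) auto
    with lower[OF f B e]
    show "\<forall>\<^sub>F n in sequentially. dist (\<integral>x. f x \<partial>Qs n) (\<integral>x. f x \<partial>P) < e"
      by eventually_elim (use \<open>0 < e\<close> in \<open>simp add: dist_real_def abs_less_iff\<close>)
  qed
qed

subsection \<open>Velocity field and loss\<close>

text \<open>y \<ge> 0 places the set g > y inside the region where g is C1. The bound therefore
  holds at every x, which later gives uniform and not merely almost everywhere convergence.\<close>

lemma CVaR_velocity_component_norm_le:
  fixes g :: "'a::euclidean_space \<Rightarrow> real"
  assumes \<alpha>: "\<alpha> < 1" and lam: "0 < lam"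
    and g: "C-lipschitz_on UNIV g" and C1: "C1_on {x. g x \<noteq> 0} g" and y: "0 \<le> y"
  shows "norm (CVaR_velocity_component lam \<alpha> g Q P y x)
    \<le> 2 * lam / (1 - \<alpha>) * C * \<bar>CVaR_gap \<alpha> g Q P\<bar>"
proof (cases "y < g x")
  case True
  then have "norm (grad g x) \<le> C"
    using y C1 by (intro lipschitz_norm_grad_le[OF g]) (auto simp: C1_on_def)
  then have "\<bar>2 * lam / (1 - \<alpha>) * CVaR_gap \<alpha> g Q P\<bar> * norm (grad g x)
      \<le> \<bar>2 * lam / (1 - \<alpha>) * CVaR_gap \<alpha> g Q P\<bar> * C"
    by (intro mult_left_mono) auto
  then show ?thesis using True \<alpha> lam
    by (simp add: CVaR_velocity_component_def abs_mult ac_simps)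
qed (use \<alpha> lam lipschitz_on_nonneg[OF g] in \<open>simp add: CVaR_velocity_component_def\<close>)

lemma velocity_eq:
  "velocity lam \<alpha> g Q P \<phi> y x = - grad \<phi> x + CVaR_velocity_component lam \<alpha> g Q P y x"
  by (simp add: velocity_def CVaR_velocity_component_def)

lemma loss_ge_CVaR_gap:
  assumes "P \<in> prob_measures" "0 \<le> L"
  shows "ereal (lam * (CVaR_gap \<alpha> g Q P)\<^sup>2) \<le> loss L lam \<alpha> g Q P"
  using add_right_mono[OF lip_KL_nonneg[OF assms, of Q], of "ereal (lam * (CVaR_gap \<alpha> g Q P)\<^sup>2)"]
  by (simp add: loss_def)

lemma loss_ge_lip_KL:
  assumes "0 \<le> lam"
  shows "lip_KL L Q P \<le> loss L lam \<alpha> g Q P"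
  using add_left_mono[of 0 "ereal (lam * (CVaR_gap \<alpha> g Q P)\<^sup>2)" "lip_KL L Q P"] assms
  by (simp add: loss_def)

lemma abs_le_sqrt_of_weighted_square:
  fixes d l r :: real
  assumes "0 < l" "l * d\<^sup>2 \<le> r"
  shows "l * \<bar>d\<bar> \<le> sqrt (l * r)"
proof (rule real_le_rsqrt)
  have "(l * \<bar>d\<bar>)\<^sup>2 = l * (l * d\<^sup>2)" by (simp add: power2_eq_square)
  also have "\<dots> \<le> l * r" using assms by (intro mult_left_mono) auto
  finally show "(l * \<bar>d\<bar>)\<^sup>2 \<le> l * r" .
qed

lemma CVaR_gap_tendsto_0_of_loss:
  assumes P: "P \<in> prob_measures" and L: "0 \<le> L" and lam: "0 < lam"
    and lim: "(\<lambda>n. loss L lam \<alpha> g (Qs n) P) \<longlonglongrightarrow> 0"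
  shows "(\<lambda>n. CVaR_gap \<alpha> g (Qs n) P) \<longlonglongrightarrow> 0"
proof -
  have "(\<lambda>n. ereal (lam * (CVaR_gap \<alpha> g (Qs n) P)\<^sup>2)) \<longlonglongrightarrow> 0"
    using lam by (intro tendsto_sandwich[OF _ _ tendsto_const lim])
      (auto intro!: always_eventually loss_ge_CVaR_gap P L)
  then have "(\<lambda>n. lam * (CVaR_gap \<alpha> g (Qs n) P)\<^sup>2) \<longlonglongrightarrow> 0"
    by (simp add: zero_ereal_def)
  then have "(\<lambda>n. sqrt (lam * (CVaR_gap \<alpha> g (Qs n) P)\<^sup>2 / lam)) \<longlonglongrightarrow> sqrt (0 / lam)"
    using lam by (intro tendsto_intros) auto
  then show ?thesis using lam by (simp add: tendsto_rabs_zero_iff)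
qed

lemma lip_KL_tendsto_0_of_loss:
  assumes P: "P \<in> prob_measures" and L: "0 \<le> L" and lam: "0 \<le> lam"
    and lim: "(\<lambda>n. loss L lam \<alpha> g (Qs n) P) \<longlonglongrightarrow> 0"
  shows "(\<lambda>n. lip_KL L (Qs n) P) \<longlonglongrightarrow> 0"
  by (rule tendsto_sandwich[OF _ _ tendsto_const lim])
     (auto intro!: always_eventually lip_KL_nonneg loss_ge_lip_KL P L lam)

text \<open>The competitor \<gamma> = P has zero divergence, so L times W1 bounds the regularized
  divergence; the CVaR gap is handled by its Lipschitz stability.\<close>

lemma loss_tendsto_0_of_W1:
  fixes g :: "'a::{second_countable_topology, metric_space} \<Rightarrow> real"
  assumes g: "C-lipschitz_on UNIV g" and g0: "\<And>x. 0 \<le> g x"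
    and P: "P \<in> prob_measures" "integrable P g"
    and Qs: "\<And>n. Qs n \<in> prob_measures" "\<And>n. integrable (Qs n) g"
    and \<alpha>: "0 < \<alpha>" "\<alpha> < 1" and L: "0 \<le> L"
    and lim: "(\<lambda>n. W1 (Qs n) P) \<longlonglongrightarrow> 0"
  shows "(\<lambda>n. loss L lam \<alpha> g (Qs n) P) \<longlonglongrightarrow> 0"
proof -
  have C: "0 \<le> C" using g by (rule lipschitz_on_nonneg)
  have "(\<lambda>n. CVaR_gap \<alpha> g (Qs n) P) \<longlonglongrightarrow> 0"
  proof (rule tendstoI)
    fix e :: real assume e: "0 < e"
    \<comment> \<open>Makes C * w / (1 - \<alpha>) equal to e * C / (C + 1), strictly below e; the
      added 1 also covers C = 0.\<close>
    define w where "w = e * (1 - \<alpha>) / (C + 1)"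
    have w: "0 < w" using e \<alpha> C by (simp add: w_def)
    have "C * w / (1 - \<alpha>) = e * (C / (C + 1))" using \<alpha> by (simp add: w_def)
    also have "\<dots> < e * 1" using e C by (intro mult_strict_left_mono) auto
    finally have Cw: "C * w / (1 - \<alpha>) < e" by simp
    have "\<forall>\<^sub>F n in sequentially. W1 (Qs n) P < ennreal w"
      by (rule order_tendstoD(2)[OF lim]) (use w in simp)
    then show "\<forall>\<^sub>F n in sequentially. dist (CVaR_gap \<alpha> g (Qs n) P) 0 < e"
    proof eventually_elim
      case (elim n)
      have "\<bar>CVaR_gap \<alpha> g (Qs n) P\<bar> \<le> C * w / (1 - \<alpha>)"
        using Qs P by (intro CVaR_gap_le_W1[OF g g0] \<alpha> elim) (auto dest: prob_measuresD)
      with Cw show ?case by simp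
    qed
  qed
  then have "(\<lambda>n. lam * (CVaR_gap \<alpha> g (Qs n) P)\<^sup>2) \<longlonglongrightarrow> lam * 0\<^sup>2"
    by (intro tendsto_intros)
  then have gap: "(\<lambda>n. ereal (lam * (CVaR_gap \<alpha> g (Qs n) P)\<^sup>2)) \<longlonglongrightarrow> 0"
    by (simp add: zero_ereal_def)
  have "(\<lambda>n. ereal L * enn2ereal (W1 (Qs n) P)) \<longlonglongrightarrow> ereal L * enn2ereal 0"
    by (intro tendsto_cmult_ereal tendsto_enn2erealI lim) simp
  then have W1: "(\<lambda>n. ereal L * enn2ereal (W1 (Qs n) P)) \<longlonglongrightarrow> 0"
    by (simp add: zero_ennreal.rep_eq)
  have "(\<lambda>n. lip_KL L (Qs n) P) \<longlonglongrightarrow> 0"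
    by (rule tendsto_sandwich[OF _ _ tendsto_const W1])
       (auto intro!: always_eventually lip_KL_nonneg lip_KL_le_W1 P L)
  from tendsto_add_ereal[OF _ _ this gap] show ?thesis by (simp add: loss_def)
qed

text \<open>Differentiability stands beside the first bound so that it concerns genuine gradients
  and not unspecified values of \<open>grad\<close>; finiteness of the loss is recorded because
  \<open>real_of_ereal\<close> sends infinity to 0. The limit Q to P is expressed by sequences: W1
  convergence implies vanishing loss, which in turn implies weak convergence.\<close>

theorem corollary3p9:
  fixes \<alpha> lam L Lip_g :: real
    and g \<phi> :: "real ^ 'n \<Rightarrow> real"
    and P Q :: "(real ^ 'n) measure"
  assumes "0 < \<alpha>" "\<alpha> < 1" "0 < lam" "0 < L"
    and g_nonneg: "\<And>x. 0 \<le> g x"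
    and g_Lip: "Lip_g-lipschitz_on UNIV g"
    and g_C1: "C1_on {x. g x \<noteq> 0} g"
    and P: "P \<in> prob_measures" "integrable P g"
    and Q: "Q \<in> prob_measures" "integrable Q g" "finite_first_moment Q"
    and \<phi>: "optimal_potential L Q P \<phi>"
  shows
    "CVaR_minimizers \<alpha> Q g = {VaR \<alpha> Q g .. VaR_upper \<alpha> Q g} \<and>
     (\<forall>y\<in>CVaR_minimizers \<alpha> Q g. AE x in lborel.
        \<phi> differentiable (at x) \<and> (g x > y \<longrightarrow> g differentiable (at x)) \<and>
        norm (velocity lam \<alpha> g Q P \<phi> y x)
          \<le> L + 2 * lam / (1 - \<alpha>) * Lip_g * \<bar>CVaR_gap \<alpha> g Q P\<bar>) \<and>
     loss L lam \<alpha> g Q P < \<infinity> \<and>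
     lam * (CVaR_gap \<alpha> g Q P)\<^sup>2 \<le> loss L lam \<alpha> g Q P \<and>
     (\<forall>y\<in>CVaR_minimizers \<alpha> Q g. AE x in lborel.
        norm (velocity lam \<alpha> g Q P \<phi> y x)
          \<le> L + 2 * Lip_g / (1 - \<alpha>) * sqrt (lam * real_of_ereal (loss L lam \<alpha> g Q P))) \<and>
     (\<exists>B. \<forall>y\<in>CVaR_minimizers \<alpha> Q g. AE x in lborel.
        norm (velocity lam \<alpha> g Q P \<phi> y x) \<le> B) \<and>
     (\<forall>(Qs :: nat \<Rightarrow> (real ^ 'n) measure) ys.
        (\<forall>n. Qs n \<in> prob_measures \<and> integrable (Qs n) g \<and> finite_first_moment (Qs n) \<and>
             ys n \<in> CVaR_minimizers \<alpha> (Qs n) g) \<longrightarrow>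
        ((\<lambda>n. loss L lam \<alpha> g (Qs n) P) \<longlonglongrightarrow> 0 \<longrightarrow>
           uniform_limit UNIV (\<lambda>n. CVaR_velocity_component lam \<alpha> g (Qs n) P (ys n))
             (\<lambda>_. 0) sequentially \<and>
           converges_weakly Qs P) \<and>
        ((\<lambda>n. W1 (Qs n) P) \<longlonglongrightarrow> 0 \<longrightarrow>
           (\<lambda>n. loss L lam \<alpha> g (Qs n) P) \<longlonglongrightarrow> 0))"
proof -
  note \<alpha> = \<open>0 < \<alpha>\<close> \<open>\<alpha> < 1\<close> and lam = \<open>0 < lam\<close> and L = \<open>0 < L\<close>
  note nonneg = prob_space.CVaR_minimizers_nonneg[OF prob_measuresD(1) _ g_nonneg \<alpha>]
  note component = CVaR_velocity_component_norm_le[OF \<alpha>(2) lam g_Lip g_C1]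
  have Lip: "0 \<le> Lip_g" using g_Lip by (rule lipschitz_on_nonneg)
  have \<phi>_Lip: "L-lipschitz_on UNIV \<phi>"
    using \<phi> by (simp add: optimal_potential_def is_arg_max_def Lip_functions_def)
  have minimizers: "CVaR_minimizers \<alpha> Q g = {VaR \<alpha> Q g .. VaR_upper \<alpha> Q g}"
    using Q by (intro prob_space.CVaR_minimizers_eq \<alpha> g_nonneg prob_measuresD(1))
  have velocity: "AE x in lborel.
      \<phi> differentiable (at x) \<and> (g x > y \<longrightarrow> g differentiable (at x)) \<and>
      norm (velocity lam \<alpha> g Q P \<phi> y x)
        \<le> L + 2 * lam / (1 - \<alpha>) * Lip_g * \<bar>CVaR_gap \<alpha> g Q P\<bar>"
    if y: "y \<in> CVaR_minimizers \<alpha> Q g" for y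
    \<comment> \<open>The only exceptional set is that of \<phi>, the same for every y.\<close>
    using Rademacher[OF \<phi>_Lip]
  proof eventually_elim
    case (elim x)
    have y0: "0 \<le> y" using nonneg[OF Q(1,2) y] .
    have "norm (velocity lam \<alpha> g Q P \<phi> y x)
      \<le> norm (grad \<phi> x) + norm (CVaR_velocity_component lam \<alpha> g Q P y x)"
      unfolding velocity_eq by (rule norm_triangle_le) simp
    also have "\<dots> \<le> L + 2 * lam / (1 - \<alpha>) * Lip_g * \<bar>CVaR_gap \<alpha> g Q P\<bar>"
      by (intro add_mono lipschitz_norm_grad_le[OF \<phi>_Lip elim] component y0)
    finally show ?case using elim g_C1 y0 by (auto simp: C1_on_def)
  qed
  have loss_fin: "loss L lam \<alpha> g Q P < \<infinity>"
    using lip_KL_finite[OF Q(1,3) P(1), of L] by (auto simp: loss_def)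
  have loss_ge: "lam * (CVaR_gap \<alpha> g Q P)\<^sup>2 \<le> loss L lam \<alpha> g Q P"
    using loss_ge_CVaR_gap[OF P(1)] L by simp
  \<comment> \<open>The weight \<open>lam\<close> is moved under the root as
    \<open>lam * (lam * d\<^sup>2)\<close>, whose inner factor is the penalty part of the
    loss.\<close>
  have "lam * \<bar>CVaR_gap \<alpha> g Q P\<bar> \<le> sqrt (lam * real_of_ereal (loss L lam \<alpha> g Q P))"
    using loss_ge loss_fin
    by (intro abs_le_sqrt_of_weighted_square lam) (cases "loss L lam \<alpha> g Q P"; simp)
  then have "2 * Lip_g / (1 - \<alpha>) * (lam * \<bar>CVaR_gap \<alpha> g Q P\<bar>)
      \<le> 2 * Lip_g / (1 - \<alpha>) * sqrt (lam * real_of_ereal (loss L lam \<alpha> g Q P))"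
    using Lip \<alpha> by (intro mult_left_mono) auto
  then have sqrt_bound: "2 * lam / (1 - \<alpha>) * Lip_g * \<bar>CVaR_gap \<alpha> g Q P\<bar>
      \<le> 2 * Lip_g / (1 - \<alpha>) * sqrt (lam * real_of_ereal (loss L lam \<alpha> g Q P))"
    by (simp add: ac_simps)
  have velocity_loss: "AE x in lborel. norm (velocity lam \<alpha> g Q P \<phi> y x)
      \<le> L + 2 * Lip_g / (1 - \<alpha>) * sqrt (lam * real_of_ereal (loss L lam \<alpha> g Q P))"
    if "y \<in> CVaR_minimizers \<alpha> Q g" for y
    using velocity[OF that] by eventually_elim (use sqrt_bound in linarith)
  have limits: "((\<lambda>n. loss L lam \<alpha> g (Qs n) P) \<longlonglongrightarrow> 0 \<longrightarrow>
        uniform_limit UNIV (\<lambda>n. CVaR_velocity_component lam \<alpha> g (Qs n) P (ys n))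
          (\<lambda>_. 0) sequentially \<and> converges_weakly Qs P) \<and>
      ((\<lambda>n. W1 (Qs n) P) \<longlonglongrightarrow> 0 \<longrightarrow> (\<lambda>n. loss L lam \<alpha> g (Qs n) P) \<longlonglongrightarrow> 0)"
    if Qs: "\<And>n. Qs n \<in> prob_measures" "\<And>n. integrable (Qs n) g"
      and ys: "\<And>n. ys n \<in> CVaR_minimizers \<alpha> (Qs n) g"
    for Qs :: "nat \<Rightarrow> (real ^ 'n) measure" and ys
  proof (intro conjI impI)
    assume lim: "(\<lambda>n. loss L lam \<alpha> g (Qs n) P) \<longlonglongrightarrow> 0"
    show "converges_weakly Qs P"
      using L lam
      by (intro lip_KL_tendsto_0_converges_weakly[OF P(1) Qs(1) L]
          lip_KL_tendsto_0_of_loss[OF P(1) _ _ lim]) auto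
    show "uniform_limit UNIV (\<lambda>n. CVaR_velocity_component lam \<alpha> g (Qs n) P (ys n))
        (\<lambda>_. 0) sequentially"
    proof (rule uniform_limitI)
      fix e :: real assume e: "0 < e"
      have "(\<lambda>n. 2 * lam / (1 - \<alpha>) * Lip_g * \<bar>CVaR_gap \<alpha> g (Qs n) P\<bar>)
          \<longlonglongrightarrow> 2 * lam / (1 - \<alpha>) * Lip_g * \<bar>0\<bar>"
        using L by (intro tendsto_intros CVaR_gap_tendsto_0_of_loss[OF P(1) _ lam lim]) auto
      then have "\<forall>\<^sub>F n in sequentially. 2 * lam / (1 - \<alpha>) * Lip_g * \<bar>CVaR_gap \<alpha> g (Qs n) P\<bar> < e"
        by (rule order_tendstoD) (use e in simp)
      then show "\<forall>\<^sub>F n in sequentially. \<forall>x\<in>UNIV.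
          dist (CVaR_velocity_component lam \<alpha> g (Qs n) P (ys n) x) 0 < e"
      proof eventually_elim
        case (elim n)
        have "0 \<le> ys n" by (rule nonneg[OF Qs(1,2) ys])
        with elim show ?case
          using component[of "ys n" "Qs n" P] by (auto intro: le_less_trans)
      qed
    qed
  next
    assume "(\<lambda>n. W1 (Qs n) P) \<longlonglongrightarrow> 0"
    then show "(\<lambda>n. loss L lam \<alpha> g (Qs n) P) \<longlonglongrightarrow> 0"
      using L by (intro loss_tendsto_0_of_W1[OF g_Lip g_nonneg P Qs \<alpha>]) auto
  qed
  have "\<exists>B. \<forall>y\<in>CVaR_minimizers \<alpha> Q g. AE x in lborel. norm (velocity lam \<alpha> g Q P \<phi> y x) \<le> B"
    using velocity_loss by blast
  then show ?thesis
    using minimizers velocity loss_fin loss_ge velocity_loss limits by blast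
qed

end
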